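(* Let $c^{(2)}$ be a bivariate copula density and let $\{c^{(1)}_{1,1:n}:n\ge1\}$ and $\{c^{(3)}_{1,1:n}:n\ge1\}$ be two families of 1-exchangeable copula densities. For $n\ge1$ and $u_j,v_j\in[0,1]$ define $$c_{2,1:n}\{(u_1,v_1),\ldots,(u_n,v_n)\}=c^{(1)}_{1,1:n}(u_1,\ldots,u_n)\times\prod_{j=1}^n c^{(2)}(u_j,v_j)\times c^{(3)}_{1,1:n}\{C_{2|1}(v_1|u_1),\ldots,C_{2|1}(v_n|u_n)\}.$$ Then for every $n$, $c_{2,1:n}$ is a ($2n$-variate) copula density; the family of distributions with densities $\{c_{2,1:n}:n\ge1\}$ is 2-exchangeable; and, for every $n\ge 2$, if $(U_1,V_1),\ldots,(U_n,V_n)$ has joint density $c_{2,1:n}$, the partial conditional independence property holds: for each $j=1,\ldots,n$, $V_j$ is independent of $\{U_k:k\neq j\}$ conditionally on $U_j$.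
   Context: A copula density is the density (with respect to Lebesgue measure) of a distribution on the unit cube with uniform $(0,1)$ univariate margins. $C^{(2)}$ is the copula with density $c^{(2)}$, and $C_{2|1}(v|u)=\partial C^{(2)}(u,v)/\partial u=\int_0^v c^{(2)}(u,t)\,dt$ is the conditional cdf of the second variable given the first. A family $\{F_{d,1:n}(\boldsymbol{z}_1,\ldots,\boldsymbol{z}_n):\boldsymbol{z}_j\in\mathbb{R}^d,\ n=1,2,\ldots\}$ of cdfs is $d$-exchangeable if for all $n\ge2$: (i) $F_{d,1:n}(\boldsymbol{z}_1,\ldots,\boldsymbol{z}_n)=F_{d,1:n}(\boldsymbol{z}_{\pi(1)},\ldots,\boldsymbol{z}_{\pi(n)})$ for every permutation $\pi$ of $\{1,\ldots,n\}$; (ii) for every $r\le n$, $F_{d,1:r}(\boldsymbol{z}_1,\ldots,\boldsymbol{z}_r)=F_{d,1:n}(\boldsymbol{z}_1,\ldots,\boldsymbol{z}_r,\infty,\ldots,\infty)$. For 2-exchangeability of $\{c_{2,1:n}\}$ the unit vectors are $\boldsymbol{z}_j=(u_j,v_j)$. A family of 1-exchangeable copula densities $\{c_{1,1:n}:n\ge1\}$ consists of $n$-variate copula densities (with $c_{1,1:1}\equiv1$) whose cdfs form a 1-exchangeable family. *)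

theory Defs
  imports "HOL-Probability.Probability"
begin

text \<open>
  Samples of size \<open>n\<close> of \<open>d\<close>-dimensional vectors are points of
  \<open>PiM {1..n} (\<lambda>_. lborel)\<close> over a Euclidean type of dimension \<open>d\<close>: \<open>real\<close> for \<open>d = 1\<close> and
  \<open>real \<times> real\<close> for \<open>d = 2\<close>. The order on the Euclidean type is componentwise.
\<close>

abbreviation lborel_n :: "nat \<Rightarrow> (nat \<Rightarrow> 'a::euclidean_space) measure" where
  "lborel_n n \<equiv> PiM {1..n} (\<lambda>_. lborel)"

text \<open>
  Densities on the unit cube are extended by zero to the whole space. \<open>L\<close> is Lebesgue measure on
  that space and \<open>P\<close> is the set of its univariate coordinate projections.
\<close>

definition copula_density :: "'b measure \<Rightarrow> ('b \<Rightarrow> real) set \<Rightarrow> ('b \<Rightarrow> real) \<Rightarrow> bool" where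
  "copula_density L P c \<longleftrightarrow>
     c \<in> borel_measurable L \<and>
     (\<forall>x\<in>space L. 0 \<le> c x) \<and>
     (\<forall>x\<in>space L. (\<exists>p\<in>P. p x \<notin> {0..1}) \<longrightarrow> c x = 0) \<and>
     prob_space (density L (\<lambda>x. ennreal (c x))) \<and>
     (\<forall>p\<in>P. distr (density L (\<lambda>x. ennreal (c x))) borel p = uniform_measure lborel {0..1})"

definition coords1 :: "nat \<Rightarrow> ((nat \<Rightarrow> real) \<Rightarrow> real) set" where
  "coords1 n = (\<lambda>j x. x j) ` {1..n}"

definition coords2 :: "nat \<Rightarrow> ((nat \<Rightarrow> real \<times> real) \<Rightarrow> real) set" where
  "coords2 n = (\<lambda>j x. fst (x j)) ` {1..n} \<union> (\<lambda>j x. snd (x j)) ` {1..n}"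

definition joint_cdf ::
    "nat \<Rightarrow> ((nat \<Rightarrow> 'a::ordered_euclidean_space) \<Rightarrow> real) \<Rightarrow> (nat \<Rightarrow> 'a) \<Rightarrow> real" where
  "joint_cdf n c z =
     measure (density (lborel_n n) (\<lambda>x. ennreal (c x)))
       {x \<in> space (lborel_n n). \<forall>j\<in>{1..n}. x j \<le> z j}"

text \<open>
  \<open>d\<close>-exchangeability of a family of cdfs, where \<open>d = DIM('a)\<close>. The value at infinite arguments is
  the limit as all their components tend to \<open>+\<infinity>\<close>; \<open>at_top\<close> is the filter of the componentwise order.
\<close>

definition exchangeable ::
    "(nat \<Rightarrow> (nat \<Rightarrow> 'a::ordered_euclidean_space) \<Rightarrow> real) \<Rightarrow> bool" where
  "exchangeable F \<longleftrightarrow>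
     (\<forall>n\<ge>2.
        (\<forall>\<pi> z. \<pi> permutes {1..n} \<longrightarrow> F n z = F n (\<lambda>j. z (\<pi> j))) \<and>
        (\<forall>r\<in>{1..n}. \<forall>z.
           ((\<lambda>t. F n (\<lambda>j. if j \<le> r then z j else t)) \<longlongrightarrow> F r z) at_top))"

definition exchangeable_copula_densities :: "(nat \<Rightarrow> (nat \<Rightarrow> real) \<Rightarrow> real) \<Rightarrow> bool" where
  "exchangeable_copula_densities c \<longleftrightarrow>
     (\<forall>n\<ge>1. copula_density (lborel_n n) (coords1 n) (c n)) \<and>
     (\<forall>x\<in>space (lborel_n 1). x 1 \<in> {0..1} \<longrightarrow> c 1 x = 1) \<and>
     exchangeable (\<lambda>n. joint_cdf n (c n))"

definition cond_cdf :: "(real \<times> real \<Rightarrow> real) \<Rightarrow> real \<Rightarrow> real \<Rightarrow> real" where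
  "cond_cdf c2 v u = (LINT t:{0..v}|lborel. c2 (u, t))"

text \<open>
  The tuples passed to \<open>c1\<close> and \<open>c3\<close> are restricted to \<open>{1..n}\<close> since points of a product space
  are extensional.
\<close>

definition joint_density ::
    "(nat \<Rightarrow> (nat \<Rightarrow> real) \<Rightarrow> real) \<Rightarrow> (real \<times> real \<Rightarrow> real) \<Rightarrow> (nat \<Rightarrow> (nat \<Rightarrow> real) \<Rightarrow> real) \<Rightarrow>
     nat \<Rightarrow> (nat \<Rightarrow> real \<times> real) \<Rightarrow> real" where
  "joint_density c1 c2 c3 n z =
     c1 n (\<lambda>j\<in>{1..n}. fst (z j)) *
     (\<Prod>j=1..n. c2 (fst (z j), snd (z j))) *
     c3 n (\<lambda>j\<in>{1..n}. cond_cdf c2 (snd (z j)) (fst (z j)))"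

text \<open>\<open>X\<close> and \<open>Y\<close> are independent conditionally on \<open>Z\<close>.\<close>

definition cond_indep_var ::
    "'m measure \<Rightarrow> 'a measure \<Rightarrow> ('m \<Rightarrow> 'a) \<Rightarrow> 'b measure \<Rightarrow> ('m \<Rightarrow> 'b) \<Rightarrow>
     'c measure \<Rightarrow> ('m \<Rightarrow> 'c) \<Rightarrow> bool" where
  "cond_indep_var M MX X MY Y MZ Z \<longleftrightarrow>
     X \<in> measurable M MX \<and> Y \<in> measurable M MY \<and> Z \<in> measurable M MZ \<and>
     (\<forall>A\<in>sets MX. \<forall>B\<in>sets MY.
        let E = real_cond_exp M (vimage_algebra (space M) Z MZ) in
        AE \<omega> in M. E (indicator ((X -` A) \<inter> (Y -` B) \<inter> space M)) \<omega> =
          E (indicator (X -` A \<inter> space M)) \<omega> * E (indicator (Y -` B \<inter> space M)) \<omega>)"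

end

(* Let Q(w|u) be the quantile function of the conditional cdf C_{2|1}(.|u). For almost every u,
   Q(.|u) maps the uniform law to the law with density c2(u, .), and it is a right inverse of
   C_{2|1}(.|u) because the latter is continuous. Hence the law with density c_{2,1:n} is the
   law of (U_j, Q(W_j|U_j))_j where U has density c1_n, W has density c3_n, and U and W are
   independent. Permutation invariance, consistency and the margins pass from U and W to this
   image, and V_j depends only on U_j and on W_j, which is uniform and independent of U. *)
theory Submission
  imports Defs
begin

section \<open>Finite products and distribution functions\<close>

text \<open>Substituting \<open>w = C_{2|1}(v|u)\<close> directly would require a Jacobian
  \<open>c2 (u, v)\<close>, which may vanish, and a conditional cdf that need not be strictly
  increasing. Instead, the product of the \<open>c2\<close> factors is absorbed into the reference
  measure, which then consists of independent copies of the law of \<open>(U, Q(W|U))\<close> with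
  \<open>U\<close>, \<open>W\<close> independent and uniform. Only the \<open>c1\<close> and
  \<open>c3\<close> factors remain as a density. A density on an image measure pulls back through
  the map, and the right inverse property turns the argument of \<open>c3\<close> into
  \<open>w\<close> itself. Two mismatches are bridged on the way. The copula densities refer to
  Lebesgue measure, but since they vanish off the cube they are also densities for independent
  uniforms. Exchangeability is stated through cdfs, but an orthant in the \<open>(u_j, v_j)\<close>
  need not pull back to an orthant in \<open>(u, w)\<close>; cdf identities are therefore converted
  to identities of laws, transported, and converted back.\<close>

lemma PiM_density:
  assumes "finite I" and f [measurable]: "f \<in> borel_measurable M"
    and "sigma_finite_measure M" "sigma_finite_measure (density M f)"
  shows "PiM I (\<lambda>_. density M f) = density (PiM I (\<lambda>_. M)) (\<lambda>x. \<Prod>i\<in>I. f (x i))"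
proof (rule sym)
  interpret M: product_sigma_finite "\<lambda>_. M" by (simp add: product_sigma_finite_def assms)
  interpret D: product_sigma_finite "\<lambda>_. density M f" by (simp add: product_sigma_finite_def assms)
  show "density (PiM I (\<lambda>_. M)) (\<lambda>x. \<Prod>i\<in>I. f (x i)) = PiM I (\<lambda>_. density M f)"
  proof (rule D.PiM_eqI[OF \<open>finite I\<close>])
    show "sets (density (PiM I (\<lambda>_. M)) (\<lambda>x. \<Prod>i\<in>I. f (x i))) = PiM I (\<lambda>_. density M f)"
      by (auto intro!: sets_PiM_cong)
    fix A assume A: "\<And>i. i \<in> I \<Longrightarrow> A i \<in> sets (density M f)"
    then have [measurable]: "i \<in> I \<Longrightarrow> A i \<in> sets M" for i by simp
    have [measurable]: "Pi\<^sub>E I A \<in> sets (PiM I (\<lambda>_. M))"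
      using A \<open>finite I\<close> by (intro sets_PiM_I_finite) auto
    have "density (PiM I (\<lambda>_. M)) (\<lambda>x. \<Prod>i\<in>I. f (x i)) (Pi\<^sub>E I A) =
        (\<integral>\<^sup>+x. (\<Prod>i\<in>I. f (x i)) * indicator (Pi\<^sub>E I A) x \<partial>PiM I (\<lambda>_. M))"
      by (rule emeasure_density) measurable
    also have "\<dots> = (\<integral>\<^sup>+x. (\<Prod>i\<in>I. f (x i) * indicator (A i) (x i)) \<partial>PiM I (\<lambda>_. M))"
    proof (rule nn_integral_cong)
      fix x assume "x \<in> space (PiM I (\<lambda>_. M))"
      then have "indicator (Pi\<^sub>E I A) x = (\<Prod>i\<in>I. indicator (A i) (x i) :: ennreal)"
        using \<open>finite I\<close> by (auto simp: indicator_def space_PiM PiE_iff prod_zero_iff)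
      then show "(\<Prod>i\<in>I. f (x i)) * indicator (Pi\<^sub>E I A) x = (\<Prod>i\<in>I. f (x i) * indicator (A i) (x i))"
        by (simp add: prod.distrib)
    qed
    also have "\<dots> = (\<Prod>i\<in>I. \<integral>\<^sup>+x. f x * indicator (A i) x \<partial>M)"
      by (rule M.product_nn_integral_prod[OF \<open>finite I\<close>]) measurable
    also have "\<dots> = (\<Prod>i\<in>I. emeasure (density M f) (A i))"
      by (intro prod.cong) (auto simp: emeasure_density)
    finally show "density (PiM I (\<lambda>_. M)) (\<lambda>x. \<Prod>i\<in>I. f (x i)) (Pi\<^sub>E I A) =
      (\<Prod>i\<in>I. emeasure (density M f) (A i))" .
  qed
qed

text \<open>Regroups coordinates: independent pairs \<open>(u_i, w_i)\<close> amount to two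
  independent vectors \<open>u\<close> and \<open>w\<close>. On a box the integrand is a product
  over \<open>i\<close>, so \<open>w\<close> can be integrated out coordinatewise for fixed
  \<open>u\<close>, and then \<open>u\<close> in the same way.\<close>

lemma PiM_distr_pair:
  assumes "finite I" and \<phi> [measurable]: "\<phi> \<in> M \<Otimes>\<^sub>M N \<rightarrow>\<^sub>M S"
    and M: "prob_space M" and N: "prob_space N"
  shows "PiM I (\<lambda>_. distr (M \<Otimes>\<^sub>M N) S \<phi>) =
    distr (PiM I (\<lambda>_. M) \<Otimes>\<^sub>M PiM I (\<lambda>_. N)) (PiM I (\<lambda>_. S))
      (\<lambda>p. \<lambda>i\<in>I. \<phi> (fst p i, snd p i))" (is "_ = distr ?P ?S ?\<Phi>")
proof (rule sym)
  interpret M: prob_space M by fact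
  interpret N: prob_space N by fact
  interpret MN: pair_prob_space M N ..
  interpret PM: product_prob_space "\<lambda>_. M" I ..
  interpret PN: product_prob_space "\<lambda>_. N" I ..
  interpret P: pair_prob_space "PiM I (\<lambda>_. M)" "PiM I (\<lambda>_. N)" ..
  interpret K: prob_space "distr (M \<Otimes>\<^sub>M N) S \<phi>" by (rule MN.prob_space_distr) fact
  interpret K: product_sigma_finite "\<lambda>_. distr (M \<Otimes>\<^sub>M N) S \<phi>"
    by standard
  have \<Phi> [measurable]: "?\<Phi> \<in> ?P \<rightarrow>\<^sub>M ?S" by measurable
  show "distr ?P ?S ?\<Phi> = PiM I (\<lambda>_. distr (M \<Otimes>\<^sub>M N) S \<phi>)"
  proof (rule K.PiM_eqI[OF \<open>finite I\<close>])
    show "sets (distr ?P ?S ?\<Phi>) = PiM I (\<lambda>_. distr (M \<Otimes>\<^sub>M N) S \<phi>)"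
      by (auto intro!: sets_PiM_cong)
    fix A assume A: "\<And>i. i \<in> I \<Longrightarrow> A i \<in> sets (distr (M \<Otimes>\<^sub>M N) S \<phi>)"
    then have [measurable]: "i \<in> I \<Longrightarrow> A i \<in> sets S" for i by simp
    have [measurable]: "Pi\<^sub>E I A \<in> sets ?S"
      using A \<open>finite I\<close> by (intro sets_PiM_I_finite) auto
    have "distr ?P ?S ?\<Phi> (Pi\<^sub>E I A) = (\<integral>\<^sup>+p. indicator (Pi\<^sub>E I A) p \<partial>distr ?P ?S ?\<Phi>)"
      by simp
    also have "\<dots> = (\<integral>\<^sup>+p. indicator (Pi\<^sub>E I A) (?\<Phi> p) \<partial>?P)"
      by (rule nn_integral_distr) measurable
    also have "\<dots> = (\<integral>\<^sup>+u. \<integral>\<^sup>+w. indicator (Pi\<^sub>E I A) (?\<Phi> (u, w)) \<partial>PiM I (\<lambda>_. N) \<partial>PiM I (\<lambda>_. M))"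
      by (rule PN.nn_integral_fst[symmetric]) measurable
    also have "\<dots> = (\<integral>\<^sup>+u. \<integral>\<^sup>+w. (\<Prod>i\<in>I. indicator (A i) (\<phi> (u i, w i)))
        \<partial>PiM I (\<lambda>_. N) \<partial>PiM I (\<lambda>_. M))"
      using \<open>finite I\<close>
      by (intro nn_integral_cong) (auto simp: indicator_def PiE_iff prod_zero_iff)
    also have "\<dots> = (\<integral>\<^sup>+u. (\<Prod>i\<in>I. \<integral>\<^sup>+w. indicator (A i) (\<phi> (u i, w)) \<partial>N) \<partial>PiM I (\<lambda>_. M))"
    proof (rule nn_integral_cong)
      fix u assume u: "u \<in> space (PiM I (\<lambda>_. M))"
      then have [measurable]: "i \<in> I \<Longrightarrow> u i \<in> space M" for i
        by (auto simp: space_PiM)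
      show "(\<integral>\<^sup>+w. (\<Prod>i\<in>I. indicator (A i) (\<phi> (u i, w i))) \<partial>PiM I (\<lambda>_. N)) =
        (\<Prod>i\<in>I. \<integral>\<^sup>+w. indicator (A i) (\<phi> (u i, w)) \<partial>N)"
        by (rule PN.product_nn_integral_prod[OF \<open>finite I\<close>]) measurable
    qed
    also have "\<dots> = (\<Prod>i\<in>I. \<integral>\<^sup>+u. \<integral>\<^sup>+w. indicator (A i) (\<phi> (u, w)) \<partial>N \<partial>M)"
      by (rule PM.product_nn_integral_prod[OF \<open>finite I\<close>]) measurable
    also have "\<dots> = (\<Prod>i\<in>I. emeasure (distr (M \<Otimes>\<^sub>M N) S \<phi>) (A i))"
    proof (rule prod.cong[OF refl])
      fix i assume [simp]: "i \<in> I"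
      have "(\<integral>\<^sup>+u. \<integral>\<^sup>+w. indicator (A i) (\<phi> (u, w)) \<partial>N \<partial>M) = (\<integral>\<^sup>+p. indicator (A i) (\<phi> p) \<partial>(M \<Otimes>\<^sub>M N))"
        by (rule N.nn_integral_fst) measurable
      also have "\<dots> = (\<integral>\<^sup>+s. indicator (A i) s \<partial>distr (M \<Otimes>\<^sub>M N) S \<phi>)"
        by (rule nn_integral_distr[symmetric]) measurable
      finally show "(\<integral>\<^sup>+u. \<integral>\<^sup>+w. indicator (A i) (\<phi> (u, w)) \<partial>N \<partial>M) =
          emeasure (distr (M \<Otimes>\<^sub>M N) S \<phi>) (A i)" by simp
    qed
    finally show "distr ?P ?S ?\<Phi> (Pi\<^sub>E I A) = (\<Prod>i\<in>I. emeasure (distr (M \<Otimes>\<^sub>M N) S \<phi>) (A i))" .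
  qed
qed

section \<open>Orthants and multivariate distribution functions\<close>

lemma Collect_all_le_sets [measurable]:
  fixes z :: "'i \<Rightarrow> 'a::ordered_euclidean_space"
  assumes "finite I"
  shows "{x \<in> space (PiM I (\<lambda>_. lborel)). \<forall>j\<in>I. x j \<le> z j} \<in> sets (PiM I (\<lambda>_. lborel))"
proof -
  have "{x \<in> space (PiM I (\<lambda>_. lborel)). \<forall>j\<in>I. x j \<le> z j} = (\<Pi>\<^sub>E j\<in>I. {..z j})"
    by (auto simp: space_PiM PiE_iff extensional_def)
  then show ?thesis using assms by (auto intro!: sets_PiM_I_finite)
qed

text \<open>The diagonal points are cofinal in the componentwise order, even against finitely many
  vectors at once, since the sum of the norms bounds every coordinate. They serve as a countable
  sequence for exhaustion by orthants and for limits along \<open>at_top\<close>.\<close>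

lemma exists_nat_scaleR_One_ge:
  fixes x :: "'i \<Rightarrow> 'a::ordered_euclidean_space"
  assumes "finite I"
  shows "\<exists>k::nat. \<forall>i\<in>I. x i \<le> real k *\<^sub>R One"
proof -
  obtain k :: nat where k: "(\<Sum>i\<in>I. norm (x i)) \<le> real k" using real_arch_simple by blast
  have "x i \<bullet> b \<le> real k" if "i \<in> I" "b \<in> Basis" for i b
  proof -
    have "x i \<bullet> b \<le> norm (x i)"
      using Basis_le_norm[OF that(2), of "x i"] by linarith
    also have "\<dots> \<le> (\<Sum>i\<in>I. norm (x i))"
      using that(1) assms by (intro member_le_sum) auto
    finally show ?thesis using k by simp
  qed
  then show ?thesis by (intro exI[of _ k]) (simp add: eucl_le[where 'a='a])
qed

lemma scaleR_One_mono: "a \<le> b \<Longrightarrow> a *\<^sub>R One \<le> (b *\<^sub>R One :: 'a::ordered_euclidean_space)"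
  by (simp add: eucl_le[where 'a='a])

text \<open>Orthants are closed under intersection (componentwise \<open>inf\<close>), generate the
  product sigma-algebra and exhaust the space along the diagonal, so two finite measures that agree
  on them coincide.\<close>

lemma measure_eqI_cdf_PiM:
  fixes P Q :: "('i \<Rightarrow> 'a::ordered_euclidean_space) measure"
  assumes "finite I" "finite_measure P" "finite_measure Q"
    and sP: "sets P = sets (PiM I (\<lambda>_. lborel))" and sQ: "sets Q = sets (PiM I (\<lambda>_. lborel))"
    and eq: "\<And>z. measure P {x \<in> space (PiM I (\<lambda>_. lborel)). \<forall>j\<in>I. x j \<le> z j} =
      measure Q {x \<in> space (PiM I (\<lambda>_. lborel)). \<forall>j\<in>I. x j \<le> z j}"
  shows "P = Q"
proof -
  interpret P: finite_measure P by fact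
  interpret Q: finite_measure Q by fact
  define E :: "('i \<Rightarrow> 'a) set set" where "E = range (\<lambda>z. \<Pi>\<^sub>E j\<in>I. {..z j})"
  have box: "{x \<in> space (PiM I (\<lambda>_. lborel)). \<forall>j\<in>I. x j \<le> z j} = (\<Pi>\<^sub>E j\<in>I. {..z j})" for z :: "'i \<Rightarrow> 'a"
    by (auto simp: space_PiM PiE_iff extensional_def)
  have un: "(\<Union>k. {..real k *\<^sub>R One}) = (UNIV :: 'a set)"
    using exists_nat_scaleR_One_ge[of "{()}" "\<lambda>_. _ :: 'a"] by auto
  \<comment> \<open>Allowing \<open>I\<close> as the only block of constrained coordinates makes the
    generators full orthants; the countable covers by diagonal orthants pay for this.\<close>
  have "sets (PiM I (\<lambda>_. sigma UNIV (range (\<lambda>a::'a. {..a})))) =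
    sets (sigma (\<Pi>\<^sub>E i\<in>I. UNIV)
      {{f\<in>(\<Pi>\<^sub>E i\<in>I. UNIV). \<forall>i\<in>j. f i \<in> A i} | A j. j \<in> {I} \<and> A \<in> Pi j (\<lambda>_. range (\<lambda>a::'a. {..a}))})"
    using assms(1)
  proof (intro sets_PiM_sigma)
    show "\<exists>S\<subseteq>range (\<lambda>a::'a. {..a}). countable S \<and> UNIV = \<Union> S" for i
      by (rule exI[of _ "range (\<lambda>k::nat. {..real k *\<^sub>R One})"]) (use un in auto)
  qed auto
  also have "{{f\<in>(\<Pi>\<^sub>E i\<in>I. UNIV). \<forall>i\<in>j. f i \<in> A i} | A j. j \<in> {I} \<and> A \<in> Pi j (\<lambda>_. range (\<lambda>a::'a. {..a}))} = E"
    (is "?L = _")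
  proof (intro equalityI subsetI)
    fix X assume "X \<in> ?L"
    then obtain A where X: "X = {f\<in>(\<Pi>\<^sub>E i\<in>I. UNIV). \<forall>i\<in>I. f i \<in> A i}"
      and A: "A \<in> Pi I (\<lambda>_. range (\<lambda>a::'a. {..a}))" by auto
    from A have "\<forall>i\<in>I. \<exists>a. A i = {..a}" by auto
    then obtain z where "\<forall>i\<in>I. A i = {..z i}" by metis
    then have "X = (\<Pi>\<^sub>E j\<in>I. {..z j})" unfolding X by (auto simp: PiE_iff extensional_def)
    then show "X \<in> E" by (auto simp: E_def)
  next
    fix X assume "X \<in> E"
    then obtain z where z: "X = (\<Pi>\<^sub>E j\<in>I. {..z j})" by (auto simp: E_def)
    show "X \<in> ?L"
      by (rule CollectI, rule exI[of _ "\<lambda>j. {..z j}"], rule exI[of _ I]) (auto simp: z PiE_iff extensional_def)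
  qed
  finally have gen: "sets (PiM I (\<lambda>_. lborel :: 'a measure)) = sigma_sets (\<Pi>\<^sub>E i\<in>I. UNIV) E"
    by (auto simp: borel_eq_atMost[symmetric] E_def sets_measure_of_conv PiE_iff
        cong: sets_PiM_cong)
  show ?thesis
  proof (rule measure_eqI_generator_eq)
    show "E \<subseteq> Pow (\<Pi>\<^sub>E i\<in>I. UNIV)" by (auto simp: E_def PiE_iff)
    show "Int_stable E"
    proof (rule Int_stableI)
      fix a b assume "a \<in> E" "b \<in> E"
      then obtain z y where "a = (\<Pi>\<^sub>E j\<in>I. {..z j})" "b = (\<Pi>\<^sub>E j\<in>I. {..y j})" by (auto simp: E_def)
      then have "a \<inter> b = (\<Pi>\<^sub>E j\<in>I. {..inf (z j) (y j)})"
        by (auto simp: PiE_iff)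
      then show "a \<inter> b \<in> E" by (auto simp: E_def)
    qed
    show "emeasure P X = emeasure Q X" if "X \<in> E" for X
      using that eq by (auto simp: E_def box P.emeasure_eq_measure Q.emeasure_eq_measure)
    show "range (\<lambda>k::nat. \<Pi>\<^sub>E j\<in>I. {..real k *\<^sub>R One}) \<subseteq> E" by (auto simp: E_def)
    show "(\<Union>k. \<Pi>\<^sub>E j\<in>I. {..real k *\<^sub>R One}) = (\<Pi>\<^sub>E i\<in>I. UNIV :: 'a set)"
    proof (intro equalityI subsetI)
      fix x :: "'i \<Rightarrow> 'a" assume x: "x \<in> (\<Pi>\<^sub>E i\<in>I. UNIV)"
      obtain k :: nat where "\<forall>i\<in>I. x i \<le> real k *\<^sub>R One"
        using exists_nat_scaleR_One_ge[OF assms(1)] by blast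
      then show "x \<in> (\<Union>k. \<Pi>\<^sub>E j\<in>I. {..real k *\<^sub>R One})"
        using x by (intro UN_I[of k]) (auto simp: PiE_iff)
    qed auto
  qed (use gen sP sQ in auto)
qed

text \<open>Continuity from below only gives the limit along the diagonal sequence. Monotonicity in
  \<open>t\<close> extends it to the filter: the measure never exceeds the limit, and above a
  diagonal point it is at least the value at that point.\<close>

lemma tendsto_measure_le_at_top:
  fixes P :: "('i \<Rightarrow> 'a::ordered_euclidean_space) measure"
  assumes "finite I" "finite_measure P" and sP: "sets P = sets (PiM I (\<lambda>_. lborel))"
    and "J \<subseteq> I"
  shows "((\<lambda>t. measure P {x \<in> space P. \<forall>j\<in>I. x j \<le> (if j \<in> J then z j else t)})
    \<longlongrightarrow> measure P {x \<in> space P. \<forall>j\<in>J. x j \<le> z j}) at_top"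
proof -
  interpret P: finite_measure P by fact
  define A where "A t = {x \<in> space P. \<forall>j\<in>I. x j \<le> (if j \<in> J then z j else t)}" for t
  define L where "L = {x \<in> space P. \<forall>j\<in>J. x j \<le> z j}"
  have sA [measurable]: "A t \<in> sets P" for t
    unfolding sP A_def sets_eq_imp_space_eq[OF sP] by (intro Collect_all_le_sets assms)
  have mono: "A s \<subseteq> A t" if "s \<le> t" for s t
    using that by (auto simp: A_def split: if_splits intro: order_trans)
  have AL: "A t \<subseteq> L" for t using \<open>J \<subseteq> I\<close> by (force simp: A_def L_def)
  have UN: "(\<Union>k. A (real k *\<^sub>R One)) = L"
  proof (intro equalityI subsetI)
    fix x assume x: "x \<in> L"
    obtain k :: nat where "\<forall>i\<in>I. x i \<le> real k *\<^sub>R One"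
      using exists_nat_scaleR_One_ge[OF assms(1)] by blast
    then show "x \<in> (\<Union>k. A (real k *\<^sub>R One))"
      using x by (intro UN_I[of k]) (auto simp: A_def L_def)
  qed (use AL in auto)
  have sL [measurable]: "L \<in> sets P" unfolding UN[symmetric] by measurable
  have "(\<lambda>k. measure P (A (real k *\<^sub>R One))) \<longlonglongrightarrow> measure P (\<Union>k. A (real k *\<^sub>R One))"
    by (rule P.finite_Lim_measure_incseq)
      (auto intro!: monoI mono scaleR_One_mono)
  then have lim: "(\<lambda>k. measure P (A (real k *\<^sub>R One))) \<longlonglongrightarrow> measure P L" by (simp add: UN)
  have "((\<lambda>t. measure P (A t)) \<longlongrightarrow> measure P L) at_top"
  proof (rule order_tendstoI)
    fix a assume "a < measure P L"
    from order_tendstoD(1)[OF lim this] obtain k where k: "a < measure P (A (real k *\<^sub>R One))"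
      by (auto simp: eventually_sequentially)
    have "a < measure P (A t)" if "real k *\<^sub>R One \<le> t" for t
      using k P.finite_measure_mono[OF mono[OF that] sA] by simp
    then show "\<forall>\<^sub>F t in at_top. a < measure P (A t)"
      unfolding at_top_def
      by (intro eventually_INF1[of "real k *\<^sub>R One"]) (auto simp: eventually_principal)
  next
    fix a assume "measure P L < a"
    then have "measure P (A t) < a" for t
      using P.finite_measure_mono[OF AL[of t] sL] by simp
    then show "\<forall>\<^sub>F t in at_top. measure P (A t) < a" by simp
  qed
  then show ?thesis by (simp add: A_def L_def)
qed

section \<open>Exchangeability as a property of laws\<close>

abbreviation law_n :: "(nat \<Rightarrow> (nat \<Rightarrow> 'a::euclidean_space) \<Rightarrow> real) \<Rightarrow> nat \<Rightarrow> (nat \<Rightarrow> 'a) measure" where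
  "law_n c n \<equiv> density (lborel_n n) (\<lambda>x. ennreal (c n x))"

abbreviation reindex :: "nat \<Rightarrow> (nat \<Rightarrow> nat) \<Rightarrow> (nat \<Rightarrow> 'a) \<Rightarrow> nat \<Rightarrow> 'a" where
  "reindex r \<tau> x \<equiv> (\<lambda>j\<in>{1..r}. x (\<tau> j))"

lemma measurable_reindex:
  assumes "\<tau> \<in> {1..r} \<rightarrow> {1..n}"
  shows "reindex r \<tau> \<in> lborel_n n \<rightarrow>\<^sub>M lborel_n r"
  using assms by (intro measurable_restrict measurable_component_singleton) auto

lemma measure_distr_reindex_le:
  fixes z :: "nat \<Rightarrow> 'a::ordered_euclidean_space"
  assumes "\<tau> \<in> {1..r} \<rightarrow> {1..n}"
  shows "measure (distr (law_n c n) (lborel_n r) (reindex r \<tau>))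
      {x \<in> space (lborel_n r). \<forall>j\<in>{1..r}. x j \<le> z j} =
    measure (law_n c n) {x \<in> space (lborel_n n). \<forall>j\<in>{1..r}. x (\<tau> j) \<le> z j}"
proof -
  have m: "reindex r \<tau> \<in> law_n c n \<rightarrow>\<^sub>M lborel_n r"
    using measurable_reindex[OF assms] by simp
  show ?thesis
    by (subst measure_distr[OF m Collect_all_le_sets])
      (use measurable_space[OF measurable_reindex[OF assms]] in \<open>auto intro!: arg_cong2[where f = measure]\<close>)
qed

lemma Collect_permute_le:
  assumes "\<pi> permutes I"
  shows "(\<forall>j\<in>I. x (\<pi> j) \<le> z (\<pi> j)) \<longleftrightarrow> (\<forall>j\<in>I. x j \<le> z j)"
  using permutes_image[OF assms] by (metis imageE imageI)

text \<open>Both conditions become equalities of image measures: relabelling by a permutation for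
  symmetry, and by the inclusion of \<open>{1..r}\<close> for the marginal of the first
  \<open>r\<close> observations. In this form they survive any map that acts in the same way on
  every coordinate.\<close>

definition exchangeable_laws :: "(nat \<Rightarrow> (nat \<Rightarrow> 'a::euclidean_space) \<Rightarrow> real) \<Rightarrow> bool" where
  "exchangeable_laws c \<longleftrightarrow>
    (\<forall>n\<ge>2. (\<forall>\<pi>. \<pi> permutes {1..n} \<longrightarrow> distr (law_n c n) (lborel_n n) (reindex n \<pi>) = law_n c n) \<and>
      (\<forall>r\<in>{1..n}. distr (law_n c n) (lborel_n r) (reindex r (\<lambda>j. j)) = law_n c r))"

text \<open>The limit in the consistency condition equals the measure of the event that constrains
  only the first \<open>r\<close> coordinates, which is a value of the cdf of their marginal; finite
  laws are determined by their cdfs. One direction is applied to \<open>c1\<close> and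
  \<open>c3\<close>, the other to the joint density.\<close>

lemma exchangeable_iff_laws:
  fixes c :: "nat \<Rightarrow> (nat \<Rightarrow> 'a::ordered_euclidean_space) \<Rightarrow> real"
  assumes prob: "\<And>n. 1 \<le> n \<Longrightarrow> prob_space (law_n c n)"
  shows "exchangeable (\<lambda>n. joint_cdf n (c n)) \<longleftrightarrow> exchangeable_laws c"
proof
  have perm_mem: "\<pi> \<in> {1..n} \<rightarrow> {1..n}" if "\<pi> permutes {1..n}" for \<pi> n
    using permutes_in_image[OF that] by auto
  have lim: "((\<lambda>t. joint_cdf n (c n) (\<lambda>j. if j \<le> r then z j else t)) \<longlongrightarrow>
      measure (law_n c n) {x \<in> space (lborel_n n). \<forall>j\<in>{1..r}. x j \<le> z j}) at_top"
    if "1 \<le> n" "r \<in> {1..n}" for n r z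
  proof -
    interpret prob_space "law_n c n" using that(1) by (rule prob)
    have "((\<lambda>t. measure (law_n c n) {x \<in> space (law_n c n). \<forall>j\<in>{1..n}. x j \<le> (if j \<in> {1..r} then z j else t)})
      \<longlongrightarrow> measure (law_n c n) {x \<in> space (law_n c n). \<forall>j\<in>{1..r}. x j \<le> z j}) at_top"
      using that(2) finite_measure_axioms by (intro tendsto_measure_le_at_top) auto
    moreover have "(\<forall>j\<in>{1..n}. x j \<le> (if j \<in> {1..r} then z j else t)) \<longleftrightarrow>
      (\<forall>j\<in>{1..n}. x j \<le> (if j \<le> r then z j else t))" for x t by auto
    ultimately show ?thesis by (simp add: joint_cdf_def cong: if_cong)
  qed
  \<comment> \<open>Uniqueness of limits requires a proper filter. The order is only partial, but
    finitely many sets \<open>{b..}\<close> always share a diagonal point.\<close>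
  have nontriv: "at_top \<noteq> (bot :: 'a filter)"
  proof
    assume "at_top = (bot :: 'a filter)"
    then have "eventually (\<lambda>_::'a. False) (INF b. principal {b..})"
      by (simp only: at_top_def[symmetric] eventually_bot)
    from eventually_INF[THEN iffD1, OF this]
    have "\<exists>B. finite B \<and> eventually (\<lambda>_::'a. False) (INF b\<in>B. principal {b..})"
      by (elim exE conjE) (intro exI conjI)
    then obtain B where "finite B" and B: "eventually (\<lambda>_::'a. False) (INF b\<in>B. principal {b..})"
      by (elim exE conjE)
    obtain k :: nat where "\<forall>b\<in>B. b \<le> real k *\<^sub>R One"
      using exists_nat_scaleR_One_ge[OF \<open>finite B\<close>, of "\<lambda>b. b"] by blast
    then have "principal {real k *\<^sub>R One :: 'a} \<le> (INF b\<in>B. principal {b..})"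
      by (intro INF_greatest) auto
    from filter_leD[OF this B] show False by (simp add: eventually_principal)
  qed
  {
    assume exch: "exchangeable (\<lambda>n. joint_cdf n (c n))"
    have perm: "joint_cdf n (c n) z = joint_cdf n (c n) (\<lambda>j. z (\<pi> j))"
      if "2 \<le> n" "\<pi> permutes {1..n}" for n \<pi> z
      using exch that unfolding exchangeable_def by blast
    have tendsto: "((\<lambda>t. joint_cdf n (c n) (\<lambda>j. if j \<le> r then z j else t)) \<longlongrightarrow> joint_cdf r (c r) z) at_top"
      if "2 \<le> n" "r \<in> {1..n}" for n r z
      using exch that unfolding exchangeable_def by blast
    have "distr (law_n c n) (lborel_n n) (reindex n \<pi>) = law_n c n"
      if n: "2 \<le> n" and \<pi>: "\<pi> permutes {1..n}" for n \<pi>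
    proof (rule measure_eqI_cdf_PiM[where I = "{1..n}"])
      interpret prob_space "law_n c n" using n by (intro prob) simp
      show "finite_measure (law_n c n)" by (rule finite_measure_axioms)
      show "finite_measure (distr (law_n c n) (lborel_n n) (reindex n \<pi>))"
        using measurable_reindex[OF perm_mem[OF \<pi>]] by (intro finite_measure_distr) simp
      fix z :: "nat \<Rightarrow> 'a"
      \<comment> \<open>Reading \<open>z j\<close> as \<open>z (inv \<pi> (\<pi> j))\<close> allows
        the constraints to be relabelled by \<open>\<pi>\<close>; the cdf hypothesis is then applied
        to the inverse permutation.\<close>
      have "measure (law_n c n) {x \<in> space (lborel_n n). \<forall>j\<in>{1..n}. x (\<pi> j) \<le> z j} =
        measure (law_n c n) {x \<in> space (lborel_n n). \<forall>j\<in>{1..n}. x (\<pi> j) \<le> z (inv \<pi> (\<pi> j))}"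
        by (simp add: permutes_inverses[OF \<pi>])
      also have "\<dots> = joint_cdf n (c n) (\<lambda>j. z (inv \<pi> j))"
        unfolding joint_cdf_def Collect_permute_le[OF \<pi>, of _ "\<lambda>j. z (inv \<pi> j)"] ..
      also have "\<dots> = joint_cdf n (c n) z"
        by (rule perm[OF n permutes_inv[OF \<pi>], symmetric])
      finally show "measure (distr (law_n c n) (lborel_n n) (reindex n \<pi>))
          {x \<in> space (lborel_n n). \<forall>j\<in>{1..n}. x j \<le> z j} =
        measure (law_n c n) {x \<in> space (lborel_n n). \<forall>j\<in>{1..n}. x j \<le> z j}"
        by (simp only: measure_distr_reindex_le[OF perm_mem[OF \<pi>]] joint_cdf_def)
    qed auto
    moreover have "distr (law_n c n) (lborel_n r) (reindex r (\<lambda>j. j)) = law_n c r"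
      if n: "2 \<le> n" and r: "r \<in> {1..n}" for n r
    proof (rule measure_eqI_cdf_PiM[where I = "{1..r}"])
      interpret prob_space "law_n c n" using n by (intro prob) simp
      interpret r: prob_space "law_n c r" using r by (intro prob) simp
      have mem: "(\<lambda>j. j) \<in> {1..r} \<rightarrow> {1..n}" using r by auto
      show "finite_measure (law_n c r)" by (rule r.finite_measure_axioms)
      show "finite_measure (distr (law_n c n) (lborel_n r) (reindex r (\<lambda>j. j)))"
        using measurable_reindex[OF mem] by (intro finite_measure_distr) simp
      fix z :: "nat \<Rightarrow> 'a"
      \<comment> \<open>The same function of \<open>t\<close> tends to the left side by continuity
        of the measure and to the right side by the consistency hypothesis.\<close>
      have "measure (law_n c n) {x \<in> space (lborel_n n). \<forall>j\<in>{1..r}. x j \<le> z j} = joint_cdf r (c r) z"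
        using n by (intro tendsto_unique[OF nontriv lim tendsto] r) simp_all
      then show "measure (distr (law_n c n) (lborel_n r) (reindex r (\<lambda>j. j)))
          {x \<in> space (lborel_n r). \<forall>j\<in>{1..r}. x j \<le> z j} =
        measure (law_n c r) {x \<in> space (lborel_n r). \<forall>j\<in>{1..r}. x j \<le> z j}"
        by (simp only: measure_distr_reindex_le[OF mem] joint_cdf_def)
    qed auto
    ultimately show "exchangeable_laws c"
      unfolding exchangeable_laws_def by blast
  next
    assume laws: "exchangeable_laws c"
    have "joint_cdf n (c n) z = joint_cdf n (c n) (\<lambda>j. z (\<pi> j))"
      if n: "2 \<le> n" and \<pi>: "\<pi> permutes {1..n}" for n \<pi> z
    proof -
      have "joint_cdf n (c n) z =
        measure (law_n c n) {x \<in> space (lborel_n n). \<forall>j\<in>{1..n}. x (\<pi> j) \<le> z (\<pi> j)}"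
        unfolding joint_cdf_def Collect_permute_le[OF \<pi>] ..
      also have "\<dots> = measure (distr (law_n c n) (lborel_n n) (reindex n \<pi>))
          {x \<in> space (lborel_n n). \<forall>j\<in>{1..n}. x j \<le> z (\<pi> j)}"
        by (rule measure_distr_reindex_le[OF perm_mem[OF \<pi>], symmetric])
      also have "\<dots> = joint_cdf n (c n) (\<lambda>j. z (\<pi> j))"
        using laws n \<pi> by (simp add: joint_cdf_def exchangeable_laws_def)
      finally show ?thesis .
    qed
    moreover have "((\<lambda>t. joint_cdf n (c n) (\<lambda>j. if j \<le> r then z j else t)) \<longlongrightarrow> joint_cdf r (c r) z) at_top"
      if n: "2 \<le> n" and r: "r \<in> {1..n}" for n r z
    proof -
      have "measure (law_n c n) {x \<in> space (lborel_n n). \<forall>j\<in>{1..r}. x j \<le> z j} =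
        measure (distr (law_n c n) (lborel_n r) (reindex r (\<lambda>j. j)))
          {x \<in> space (lborel_n r). \<forall>j\<in>{1..r}. x j \<le> z j}"
        using r by (intro measure_distr_reindex_le[symmetric]) auto
      also have "\<dots> = joint_cdf r (c r) z"
        unfolding joint_cdf_def using laws n r by (simp add: exchangeable_laws_def)
      finally show ?thesis using lim[of n r z] n r by simp
    qed
    ultimately show "exchangeable (\<lambda>n. joint_cdf n (c n))"
      unfolding exchangeable_def by blast
  }
qed

section \<open>Conditional independence\<close>

text \<open>The hypothesis says that \<open>p (Z \<omega>)\<close> is a version of the conditional
  probability of \<open>X\<close> in \<open>A\<close> given both \<open>Y\<close> and
  \<open>Z\<close>, in an integral form that Fubini can check. As \<open>p\<close> does not depend
  on \<open>B\<close>, the choice \<open>B = space MY\<close> identifies it with the conditional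
  probability given \<open>Z\<close> alone, and a function of \<open>Z\<close> can be pulled out of
  the conditional expectation of the event in \<open>Y\<close>.\<close>

lemma cond_indep_varI:
  fixes M :: "'m measure"
  assumes "prob_space M"
    and X: "X \<in> M \<rightarrow>\<^sub>M MX" and Y: "Y \<in> M \<rightarrow>\<^sub>M MY" and Z: "Z \<in> M \<rightarrow>\<^sub>M MZ"
    and kernel: "\<And>A. A \<in> sets MX \<Longrightarrow> \<exists>p :: _ \<Rightarrow> real. p \<in> borel_measurable MZ \<and> (\<forall>z. 0 \<le> p z \<and> p z \<le> 1) \<and>
      (\<forall>B\<in>sets MY. \<forall>D\<in>sets MZ.
        (\<integral>\<omega>. indicator A (X \<omega>) * indicator B (Y \<omega>) * indicator D (Z \<omega>) \<partial>M) =
        (\<integral>\<omega>. p (Z \<omega>) * indicator B (Y \<omega>) * indicator D (Z \<omega>) \<partial>M))"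
  shows "cond_indep_var M MX X MY Y MZ Z"
proof -
  interpret M: prob_space M by fact
  define F where "F = vimage_algebra (space M) Z MZ"
  have ZF: "Z \<in> F \<rightarrow>\<^sub>M MZ"
    unfolding F_def by (rule measurable_vimage_algebra1) (use measurable_space[OF Z] in auto)
  have sets_F: "sets F = {Z -` D \<inter> space M | D. D \<in> sets MZ}"
    unfolding F_def by (rule sets_vimage_algebra2) (use measurable_space[OF Z] in auto)
  have sub: "subalgebra M F"
    unfolding subalgebra_def sets_F using measurable_sets[OF Z] by (auto simp: F_def)
  interpret F: finite_measure_subalgebra M F
    by standard (rule sub)
  have "AE \<omega> in M. real_cond_exp M F (indicator ((X -` A) \<inter> (Y -` B) \<inter> space M)) \<omega> =
      real_cond_exp M F (indicator (X -` A \<inter> space M)) \<omega> * real_cond_exp M F (indicator (Y -` B \<inter> space M)) \<omega>"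
    if A: "A \<in> sets MX" and B: "B \<in> sets MY" for A B
  proof -
    from kernel[OF A] obtain p where p: "p \<in> borel_measurable MZ" and p01: "\<And>z. 0 \<le> p z \<and> p z \<le> (1::real)"
      and eq: "\<And>B D. B \<in> sets MY \<Longrightarrow> D \<in> sets MZ \<Longrightarrow>
        (\<integral>\<omega>. indicator A (X \<omega>) * indicator B (Y \<omega>) * indicator D (Z \<omega>) \<partial>M) =
        (\<integral>\<omega>. p (Z \<omega>) * indicator B (Y \<omega>) * indicator D (Z \<omega>) \<partial>M)"
      by blast
    have XA [measurable]: "X -` A \<inter> space M \<in> sets M" by (rule measurable_sets[OF X A])
    have YB [measurable]: "Y -` B \<inter> space M \<in> sets M" by (rule measurable_sets[OF Y B])
    have XYB [measurable]: "(X -` A) \<inter> (Y -` B) \<inter> space M \<in> sets M"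
      using sets.Int[OF XA YB] by (simp add: Int_ac)
    have pF [measurable]: "(\<lambda>\<omega>. p (Z \<omega>)) \<in> borel_measurable F" by (rule measurable_compose[OF ZF p])
    have pM [measurable]: "(\<lambda>\<omega>. p (Z \<omega>)) \<in> borel_measurable M" by (rule measurable_compose[OF Z p])
    have int_p: "integrable M (\<lambda>\<omega>. p (Z \<omega>))"
      by (rule M.integrable_const_bound[where B = 1]) (use p01 in auto)
    have int_ind: "integrable M (indicator S :: 'm \<Rightarrow> real)" if "S \<in> sets M" for S
      using that by (intro integrable_real_indicator) (auto simp: less_top[symmetric])
    have E_X: "AE \<omega> in M. real_cond_exp M F (indicator (X -` A \<inter> space M)) \<omega> = p (Z \<omega>)"
    proof (rule F.real_cond_exp_charact)
      fix S assume "S \<in> sets F"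
      then obtain D where D: "D \<in> sets MZ" and S: "S = Z -` D \<inter> space M" by (auto simp: sets_F)
      have "(\<integral>\<omega>\<in>S. (indicator (X -` A \<inter> space M) \<omega> :: real) \<partial>M) =
          (\<integral>\<omega>. indicator A (X \<omega>) * indicator (space MY) (Y \<omega>) * indicator D (Z \<omega>) \<partial>M)"
        unfolding set_lebesgue_integral_def S
        by (rule Bochner_Integration.integral_cong) (use measurable_space[OF Y] in \<open>auto simp: indicator_def\<close>)
      also have "\<dots> = (\<integral>\<omega>. p (Z \<omega>) * indicator (space MY) (Y \<omega>) * indicator D (Z \<omega>) \<partial>M)"
        by (rule eq[OF sets.top D])
      also have "\<dots> = (\<integral>\<omega>\<in>S. p (Z \<omega>) \<partial>M)"
        unfolding set_lebesgue_integral_def S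
        by (rule Bochner_Integration.integral_cong) (use measurable_space[OF Y] in \<open>auto simp: indicator_def\<close>)
      finally show "(\<integral>\<omega>\<in>S. (indicator (X -` A \<inter> space M) \<omega> :: real) \<partial>M) = (\<integral>\<omega>\<in>S. p (Z \<omega>) \<partial>M)" .
    qed (auto intro: int_ind int_p)
    define b :: "'m \<Rightarrow> real" where "b = indicator (Y -` B \<inter> space M)"
    have b [measurable]: "b \<in> borel_measurable M" unfolding b_def by measurable
    have int_pS: "integrable M (\<lambda>\<omega>. (indicator S \<omega> * p (Z \<omega>)) * b \<omega>)" if "S \<in> sets M" for S
    proof (rule M.integrable_const_bound[where B = 1])
      show "AE \<omega> in M. norm ((indicator S \<omega> * p (Z \<omega>)) * b \<omega>) \<le> 1"
        using p01 by (auto simp: b_def indicator_def)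
      show "(\<lambda>\<omega>. (indicator S \<omega> * p (Z \<omega>)) * b \<omega>) \<in> borel_measurable M"
        using that by measurable
    qed
    have int_pb: "integrable M (\<lambda>\<omega>. p (Z \<omega>) * b \<omega>)"
    proof (rule M.integrable_const_bound[where B = 1])
      show "AE \<omega> in M. norm (p (Z \<omega>) * b \<omega>) \<le> 1"
        using p01 by (auto simp: b_def indicator_def)
    qed measurable
    have "AE \<omega> in M. real_cond_exp M F (indicator ((X -` A) \<inter> (Y -` B) \<inter> space M)) \<omega> =
        p (Z \<omega>) * real_cond_exp M F b \<omega>"
    proof (rule F.real_cond_exp_charact)
      fix S assume SF [measurable]: "S \<in> sets F"
      then obtain D where D: "D \<in> sets MZ" and S: "S = Z -` D \<inter> space M" by (auto simp: sets_F)
      have SM [measurable]: "S \<in> sets M" using SF sub by (auto simp: subalgebra_def)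
      have "(\<integral>\<omega>\<in>S. (indicator ((X -` A) \<inter> (Y -` B) \<inter> space M) \<omega> :: real) \<partial>M) =
          (\<integral>\<omega>. indicator A (X \<omega>) * indicator B (Y \<omega>) * indicator D (Z \<omega>) \<partial>M)"
        unfolding set_lebesgue_integral_def S
        by (rule Bochner_Integration.integral_cong) (auto simp: indicator_def)
      also have "\<dots> = (\<integral>\<omega>. p (Z \<omega>) * indicator B (Y \<omega>) * indicator D (Z \<omega>) \<partial>M)"
        by (rule eq[OF B D])
      also have "\<dots> = (\<integral>\<omega>. (indicator S \<omega> * p (Z \<omega>)) * b \<omega> \<partial>M)"
        unfolding b_def S
        by (rule Bochner_Integration.integral_cong) (auto simp: indicator_def)
      \<comment> \<open>The factor in parentheses is measurable with respect to \<open>F\<close>, so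
        replacing \<open>b\<close> by its conditional expectation preserves the integral.\<close>
      also have "\<dots> = (\<integral>\<omega>. (indicator S \<omega> * p (Z \<omega>)) * real_cond_exp M F b \<omega> \<partial>M)"
        by (rule F.real_cond_exp_intg(2)[symmetric]) (use int_pS[OF SM] in measurable)
      also have "\<dots> = (\<integral>\<omega>\<in>S. p (Z \<omega>) * real_cond_exp M F b \<omega> \<partial>M)"
        unfolding set_lebesgue_integral_def by (simp add: mult.assoc)
      finally show "(\<integral>\<omega>\<in>S. (indicator ((X -` A) \<inter> (Y -` B) \<inter> space M) \<omega> :: real) \<partial>M) =
        (\<integral>\<omega>\<in>S. p (Z \<omega>) * real_cond_exp M F b \<omega> \<partial>M)" .
    next
      show "integrable M (\<lambda>\<omega>. p (Z \<omega>) * real_cond_exp M F b \<omega>)"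
        by (rule F.real_cond_exp_intg(1)[OF int_pb pF b])
    qed (auto intro: int_ind)
    then show ?thesis
      using E_X by eventually_elim (simp add: b_def)
  qed
  then show ?thesis
    using X Y Z by (simp add: cond_indep_var_def F_def Let_def)
qed

section \<open>The conditional quantile transform\<close>

abbreviation unif :: "real measure" where
  "unif \<equiv> uniform_measure lborel {0..1}"

lemma unif_eq_density: "unif = density lborel (indicator {0..1})"
  by (simp add: uniform_measure_def divide_ennreal_def)

lemma prob_space_unif: "prob_space unif"
  by (rule prob_space_uniform_measure) auto

lemma emeasure_unif:
  assumes "A \<in> sets borel"
  shows "emeasure unif A = emeasure lborel ({0..1} \<inter> A)"
  using assms by (subst emeasure_uniform_measure) (auto simp: divide_ennreal_def)

lemma nn_integral_unif:
  assumes "f \<in> borel_measurable borel"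
  shows "(\<integral>\<^sup>+x. f x \<partial>unif) = (\<integral>\<^sup>+x. f x * indicator {0..1} x \<partial>lborel)"
  using assms by (simp add: unif_eq_density nn_integral_density mult.commute)

text \<open>The endpoints form a null set; the quantile function below has its proper meaning only
  on the open interval.\<close>

lemma AE_unif: "AE w in unif. 0 < w \<and> w < (1::real)"
proof -
  have "AE w in lborel. w \<noteq> 0" "AE w in lborel. w \<noteq> (1::real)"
    by (rule AE_lborel_singleton)+
  then show ?thesis
    by (subst AE_uniform_measure) auto
qed

lemma copula_density_cubeD:
  assumes "copula_density (lborel_n n) (coords1 n) c"
  shows "c \<in> borel_measurable (lborel_n n)"
    and "x \<in> space (lborel_n n) \<Longrightarrow> 0 \<le> c x"
    and "x \<in> space (lborel_n n) \<Longrightarrow> i \<in> {1..n} \<Longrightarrow> x i \<notin> {0..1} \<Longrightarrow> c x = 0"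
    and "prob_space (density (lborel_n n) c)"
    and "i \<in> {1..n} \<Longrightarrow> distr (density (lborel_n n) c) borel (\<lambda>x. x i) = unif"
  using assms by (auto simp: copula_density_def coords1_def)

locale bivariate_copula_density =
  fixes c2 :: "real \<times> real \<Rightarrow> real"
  assumes copula: "copula_density lborel {fst, snd} c2"
begin

lemma c2_nonneg: "0 \<le> c2 p"
  using copula by (cases p) (simp add: copula_density_def)

lemma c2_outside: "u \<notin> {0..1} \<or> v \<notin> {0..1} \<Longrightarrow> c2 (u, v) = 0"
  using copula by (auto simp: copula_density_def)

lemma c2_borel [measurable]: "c2 \<in> borel_measurable borel"
  using copula by (simp add: copula_density_def)

lemma c2_borel_pair [measurable]: "c2 \<in> borel_measurable (borel \<Otimes>\<^sub>M borel)"
  using c2_borel by (simp add: borel_prod)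

lemma distr_margins:
  shows "distr (density lborel c2) borel fst = unif" "distr (density lborel c2) borel snd = unif"
  using copula by (simp_all add: copula_density_def)

section \<open>Conditional laws given the first variable and their quantile functions\<close>

definition cond_law :: "real \<Rightarrow> real measure" where
  "cond_law u = density lborel (\<lambda>v. ennreal (c2 (u, v)))"

lemma sets_cond_law [simp, measurable_cong]: "sets (cond_law u) = sets borel"
  by (simp add: cond_law_def)

lemma space_cond_law [simp]: "space (cond_law u) = UNIV"
  by (simp add: cond_law_def)

text \<open>The uniform first margin makes \<open>c2 (u, _)\<close> a probability density only for
  almost every \<open>u\<close> in the unit interval; this predicate singles out the good
  values.\<close>

definition normalized :: "real \<Rightarrow> bool" where
  "normalized u \<longleftrightarrow> (\<integral>\<^sup>+v. c2 (u, v) \<partial>lborel) = 1"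

lemma normalized_measurable [measurable]: "Measurable.pred borel normalized"
  unfolding normalized_def by measurable

text \<open>By Tonelli, integrating \<open>c2\<close> over \<open>v\<close> yields a density of the
  first margin. That margin is uniform, and Lebesgue densities are unique almost everywhere.\<close>

lemma AE_normalized: "AE u in unif. normalized u"
proof -
  have "density lborel (\<lambda>u. \<integral>\<^sup>+v. c2 (u, v) \<partial>lborel) = distr (density lborel c2) borel fst"
  proof (rule measure_eqI)
    fix A :: "real set"
    assume "A \<in> sets (density lborel (\<lambda>u. \<integral>\<^sup>+v. c2 (u, v) \<partial>lborel))"
    then have A [measurable]: "A \<in> sets borel" by simp
    have [measurable]: "fst -` A \<in> sets (borel :: (real \<times> real) measure)"
      by (rule measurable_sets_borel[OF _ A]) (simp add: borel_prod[symmetric])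
    have "emeasure (density lborel (\<lambda>u. \<integral>\<^sup>+v. c2 (u, v) \<partial>lborel)) A =
        (\<integral>\<^sup>+u. (\<integral>\<^sup>+v. c2 (u, v) \<partial>lborel) * indicator A u \<partial>lborel)"
      by (rule emeasure_density) auto
    also have "\<dots> = (\<integral>\<^sup>+u. \<integral>\<^sup>+v. ennreal (c2 (u, v)) * indicator A (fst (u, v)) \<partial>lborel \<partial>lborel)"
      by (intro nn_integral_cong) (simp add: nn_integral_multc)
    also have "\<dots> = (\<integral>\<^sup>+p. ennreal (c2 p) * indicator A (fst p) \<partial>(lborel \<Otimes>\<^sub>M lborel))"
      by (rule lborel.nn_integral_fst) measurable
    also have "\<dots> = (\<integral>\<^sup>+p. ennreal (c2 p) * indicator (fst -` A) p \<partial>lborel)"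
      unfolding lborel_prod by (intro nn_integral_cong) (simp split: split_indicator)
    also have "\<dots> = emeasure (density lborel c2) (fst -` A)"
      by (subst emeasure_density) auto
    also have "\<dots> = emeasure (distr (density lborel c2) borel fst) A"
      by (subst emeasure_distr) (auto simp: borel_prod[symmetric] space_pair_measure)
    finally show "emeasure (density lborel (\<lambda>u. \<integral>\<^sup>+v. c2 (u, v) \<partial>lborel)) A =
      emeasure (distr (density lborel c2) borel fst) A" .
  qed simp
  then have "density lborel (\<lambda>u. \<integral>\<^sup>+v. c2 (u, v) \<partial>lborel) = density lborel (indicator {0..1})"
    by (simp add: distr_margins unif_eq_density)
  then have "AE u in lborel. (\<integral>\<^sup>+v. c2 (u, v) \<partial>lborel) = indicator {0..1} u"
    by (subst (asm) sigma_finite_measure.density_unique_iff[OF sigma_finite_lborel]) auto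
  then show ?thesis
    by (subst AE_uniform_measure) (auto simp: normalized_def elim: AE_mp)
qed

lemma real_distribution_cond_law: "normalized u \<Longrightarrow> real_distribution (cond_law u)"
  by (intro real_distribution.intro prob_spaceI real_distribution_axioms.intro)
    (auto simp: cond_law_def normalized_def emeasure_density)

text \<open>Valid for every \<open>u\<close>, normalized or not: \<open>c2\<close> vanishes at
  negative arguments, so the lower limit 0 may be dropped, and if the integral diverges both sides
  take the default value 0.\<close>

lemma cond_cdf_eq_cdf: "cond_cdf c2 v u = cdf (cond_law u) v"
proof -
  have "cond_cdf c2 v u = (\<integral>t. indicator {..v} t * c2 (u, t) \<partial>lborel)"
    unfolding cond_cdf_def set_lebesgue_integral_def
    by (intro Bochner_Integration.integral_cong) (auto simp: c2_outside split: split_indicator)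
  also have "\<dots> = enn2real (\<integral>\<^sup>+t. ennreal (indicator {..v} t * c2 (u, t)) \<partial>lborel)"
    by (intro integral_eq_nn_integral) (auto simp: c2_nonneg)
  also have "(\<integral>\<^sup>+t. ennreal (indicator {..v} t * c2 (u, t)) \<partial>lborel) = emeasure (cond_law u) {..v}"
    unfolding cond_law_def
    by (subst emeasure_density) (auto intro!: nn_integral_cong split: split_indicator)
  finally show ?thesis by (simp add: cdf_def measure_def)
qed

lemma cond_cdf_measurable [measurable]:
  assumes [measurable]: "f \<in> borel_measurable M" "g \<in> borel_measurable M"
  shows "(\<lambda>x. cond_cdf c2 (f x) (g x)) \<in> borel_measurable M"
proof -
  have "(\<lambda>x. \<integral>t. indicator {t. 0 \<le> t \<and> t \<le> f x} t *\<^sub>R c2 (g x, t) \<partial>lborel) \<in> borel_measurable M"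
    by measurable
  then show ?thesis
    by (simp add: cond_cdf_def set_lebesgue_integral_def atLeastAtMost_def atLeast_def atMost_def Int_def)
qed

text \<open>The left-continuous generalized inverse of the conditional cdf. The value 0 elsewhere is
  an arbitrary default that keeps the function total and jointly measurable; for independent uniform
  arguments it is taken only on a null set.\<close>

definition quantile :: "real \<Rightarrow> real \<Rightarrow> real" where
  "quantile u w = (if normalized u \<and> 0 < w \<and> w < 1 then Inf {v. w \<le> cond_cdf c2 v u} else 0)"

text \<open>The Galois connection between a cdf and its pseudo-inverse, which rests on
  right-continuity. It gives measurability through sublevel sets, and both inequalities of the right
  inverse identity.\<close>

lemma quantile_le_iff:
  assumes "normalized u" "0 < w" "w < 1"
  shows "quantile u w \<le> v \<longleftrightarrow> w \<le> cond_cdf c2 v u"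
proof -
  interpret cdf_distribution "cond_law u"
    unfolding cdf_distribution_def by (rule real_distribution_cond_law) fact
  show ?thesis
    using pseudoinverse[of w v] assms by (simp add: quantile_def cond_cdf_eq_cdf)
qed

lemma quantile_measurable_pair: "(\<lambda>p. quantile (fst p) (snd p)) \<in> borel_measurable (borel \<Otimes>\<^sub>M borel)"
proof (rule borel_measurableI_le)
  fix y
  have "{p \<in> space (borel \<Otimes>\<^sub>M borel). quantile (fst p) (snd p) \<le> y} =
    {p \<in> space (borel \<Otimes>\<^sub>M borel). if normalized (fst p) \<and> 0 < snd p \<and> snd p < 1 then snd p \<le> cond_cdf c2 y (fst p) else 0 \<le> y}"
    using quantile_le_iff by (auto simp: quantile_def)
  also have "\<dots> \<in> sets (borel \<Otimes>\<^sub>M borel)" by measurable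
  finally show "{p \<in> space (borel \<Otimes>\<^sub>M borel). quantile (fst p) (snd p) \<le> y} \<in> sets (borel \<Otimes>\<^sub>M borel)" .
qed

lemma quantile_measurable [measurable]:
  assumes [measurable]: "f \<in> borel_measurable M" "g \<in> borel_measurable M"
  shows "(\<lambda>x. quantile (f x) (g x)) \<in> borel_measurable M"
  using measurable_compose[OF measurable_Pair[OF assms] quantile_measurable_pair] by simp

text \<open>The conditional cdf is onto \<open>(0,1)\<close> because a law with a Lebesgue density has no atoms.\<close>

lemma cond_cdf_quantile:
  assumes "normalized u" "0 < w" "w < 1"
  shows "cond_cdf c2 (quantile u w) u = w"
proof (rule antisym)
  interpret cdf_distribution "cond_law u"
    unfolding cdf_distribution_def by (rule real_distribution_cond_law) fact
  show "w \<le> cond_cdf c2 (quantile u w) u"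
    using quantile_le_iff[OF assms, of "quantile u w"] by simp
  have "emeasure (cond_law u) {quantile u w} = 0"
    unfolding cond_law_def
    using AE_lborel_singleton[of "quantile u w"]
    by (subst emeasure_density) (auto simp: nn_integral_0_iff_AE split: split_indicator elim!: AE_mp)
  then have "isCont C (quantile u w)"
    by (simp add: isCont_cdf measure_def)
  then have "((\<lambda>v. C v) \<longlongrightarrow> C (quantile u w)) (at_left (quantile u w))"
    by (rule isCont_tendsto_compose[THEN tendsto_within_subset]) (auto)
  \<comment> \<open>Strictly left of the quantile the Galois connection gives a value below
    \<open>w\<close>; continuity carries the bound to the quantile itself.\<close>
  moreover have "\<forall>\<^sub>F v in at_left (quantile u w). C v \<le> w"
    unfolding eventually_at_filter
    using quantile_le_iff[OF assms] by (intro always_eventually) (metis cond_cdf_eq_cdf lessThan_iff linorder_le_cases not_le)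
  ultimately show "cond_cdf c2 (quantile u w) u \<le> w"
    unfolding cond_cdf_eq_cdf by (rule tendsto_upperbound) simp
qed

text \<open>Inverse transform sampling. Here \<open>I\<close> is the pseudo-inverse attached to the
  cdf of \<open>cond_law u\<close>; it agrees with \<open>quantile u\<close> on the open unit
  interval, and the two base measures differ only at the endpoints.\<close>

lemma distr_quantile:
  assumes "normalized u"
  shows "distr unif borel (quantile u) = cond_law u"
proof -
  interpret cdf_distribution "cond_law u"
    unfolding cdf_distribution_def by (rule real_distribution_cond_law) fact
  have "distr unif borel (quantile u) = distr (restrict_space lborel {0<..<1}) borel I"
  proof (rule measure_eqI)
    fix A assume "A \<in> sets (distr unif borel (quantile u))"
    then have A [measurable]: "A \<in> sets borel" by simp
    have [measurable]: "quantile u -` A \<in> sets borel"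
      by (rule measurable_sets_borel[OF _ A]) measurable
    have "emeasure (distr unif borel (quantile u)) A = emeasure lborel ({0..1} \<inter> quantile u -` A)"
      by (subst emeasure_distr) (auto simp: emeasure_unif simp del: emeasure_uniform_measure)
    also have "\<dots> = emeasure lborel ({0<..<1} \<inter> quantile u -` A)"
    proof (rule emeasure_eq_AE)
      show "AE x in lborel. (x \<in> {0..1} \<inter> quantile u -` A) = (x \<in> {0<..<1} \<inter> quantile u -` A)"
        using AE_lborel_singleton[of "0::real"] AE_lborel_singleton[of "1::real"]
        by eventually_elim auto
    qed auto
    also have "{0<..<1} \<inter> quantile u -` A = {0<..<1} \<inter> I -` A"
      using assms by (auto simp: quantile_def cond_cdf_eq_cdf)
    also have "emeasure lborel ({0<..<1} \<inter> I -` A) = emeasure (distr (restrict_space lborel {0<..<1}) borel I) A"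
      using measurable_CI
      by (subst emeasure_distr)
        (auto simp: emeasure_restrict_space space_restrict_space measurable_restrict_space1 Int_commute
          cong: measurable_cong_sets sets_restrict_space_cong)
    finally show "emeasure (distr unif borel (quantile u)) A =
      emeasure (distr (restrict_space lborel {0<..<1}) borel I) A" .
  qed simp
  then show ?thesis by (simp add: distr_I_eq_M)
qed

text \<open>Disintegration over the first coordinate: for almost every \<open>u\<close> in the unit
  interval the inner integral against \<open>c2 (u, _)\<close> is an integral over a uniform
  \<open>w\<close> pushed through \<open>quantile u\<close>, and for \<open>u\<close> outside the
  interval both integrands vanish.\<close>

lemma density_c2_eq_distr:
  "density lborel c2 = distr (unif \<Otimes>\<^sub>M unif) lborel (\<lambda>p. (fst p, quantile (fst p) (snd p)))"
proof (rule measure_eqI)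
  interpret unif: prob_space unif by (rule prob_space_unif)
  have \<phi> [measurable]: "(\<lambda>p. (fst p, quantile (fst p) (snd p))) \<in> unif \<Otimes>\<^sub>M unif \<rightarrow>\<^sub>M lborel"
    by (simp add: borel_prod[symmetric])
  fix S assume "S \<in> sets (density lborel c2)"
  then have S [measurable]: "S \<in> sets borel" by simp
  then have S' [measurable]: "S \<in> sets (borel \<Otimes>\<^sub>M borel)" by (simp only: borel_prod)
  have "emeasure (density lborel c2) S = (\<integral>\<^sup>+p. ennreal (c2 p) * indicator S p \<partial>lborel)"
    by (rule emeasure_density) auto
  also have "\<dots> = (\<integral>\<^sup>+p. ennreal (c2 p) * indicator S p \<partial>(lborel \<Otimes>\<^sub>M lborel))"
    by (simp add: lborel_prod)
  also have "\<dots> = (\<integral>\<^sup>+u. \<integral>\<^sup>+v. ennreal (c2 (u, v)) * indicator S (u, v) \<partial>lborel \<partial>lborel)"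
    by (rule lborel.nn_integral_fst[symmetric]) measurable
  also have "\<dots> = (\<integral>\<^sup>+u. (\<integral>\<^sup>+w. indicator S (u, quantile u w) \<partial>unif) * indicator {0..1} u \<partial>lborel)"
  proof (rule nn_integral_cong_AE)
    have "AE u in lborel. u \<in> {0..1} \<longrightarrow> normalized u"
      using AE_normalized by (subst (asm) AE_uniform_measure) auto
    then show "AE u in lborel. (\<integral>\<^sup>+v. ennreal (c2 (u, v)) * indicator S (u, v) \<partial>lborel) =
       (\<integral>\<^sup>+w. indicator S (u, quantile u w) \<partial>unif) * indicator {0..1} u"
    proof eventually_elim
      fix u assume g: "u \<in> {0..1} \<longrightarrow> normalized u"
      show "(\<integral>\<^sup>+v. ennreal (c2 (u, v)) * indicator S (u, v) \<partial>lborel) =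
       (\<integral>\<^sup>+w. indicator S (u, quantile u w) \<partial>unif) * indicator {0..1} u"
      proof (cases "u \<in> {0..1}")
        case True
        have "(\<integral>\<^sup>+v. ennreal (c2 (u, v)) * indicator S (u, v) \<partial>lborel) = (\<integral>\<^sup>+v. indicator S (u, v) \<partial>cond_law u)"
          unfolding cond_law_def by (rule nn_integral_density[symmetric]) measurable
        also have "\<dots> = (\<integral>\<^sup>+v. indicator S (u, v) \<partial>distr unif borel (quantile u))"
          using True g by (simp add: distr_quantile)
        also have "\<dots> = (\<integral>\<^sup>+w. indicator S (u, quantile u w) \<partial>unif)"
          by (rule nn_integral_distr) measurable
        finally show ?thesis using True by simp
      qed (simp add: c2_outside)
    qed
  qed
  also have "\<dots> = (\<integral>\<^sup>+u. \<integral>\<^sup>+w. indicator S (u, quantile u w) \<partial>unif \<partial>unif)"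
    by (rule nn_integral_unif[symmetric]) measurable
  also have "\<dots> = (\<integral>\<^sup>+p. indicator S (fst p, quantile (fst p) (snd p)) \<partial>(unif \<Otimes>\<^sub>M unif))"
    by (subst unif.nn_integral_fst[symmetric]) auto
  also have "\<dots> = emeasure (distr (unif \<Otimes>\<^sub>M unif) lborel (\<lambda>p. (fst p, quantile (fst p) (snd p)))) S"
    by (subst nn_integral_distr[OF \<phi>, symmetric]) auto
  finally show "emeasure (density lborel c2) S =
    emeasure (distr (unif \<Otimes>\<^sub>M unif) lborel (\<lambda>p. (fst p, quantile (fst p) (snd p)))) S" .
qed simp

section \<open>The coupling map and the law of the joint density\<close>

definition couple :: "'i set \<Rightarrow> ('i \<Rightarrow> real) \<times> ('i \<Rightarrow> real) \<Rightarrow> 'i \<Rightarrow> real \<times> real" where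
  "couple I p = (\<lambda>j\<in>I. (fst p j, quantile (fst p j) (snd p j)))"

lemma couple_measurable:
  "couple I \<in> PiM I (\<lambda>_. lborel) \<Otimes>\<^sub>M PiM I (\<lambda>_. lborel) \<rightarrow>\<^sub>M PiM I (\<lambda>_. lborel)"
  unfolding couple_def
proof (rule measurable_restrict)
  fix j assume [measurable]: "j \<in> I"
  show "(\<lambda>p. (fst p j, quantile (fst p j) (snd p j))) \<in> PiM I (\<lambda>_. lborel) \<Otimes>\<^sub>M PiM I (\<lambda>_. lborel) \<rightarrow>\<^sub>M lborel"
    unfolding measurable_lborel2 borel_prod[symmetric] by measurable
qed

text \<open>The vector \<open>w\<close> can be read back from its image when every
  \<open>u j\<close> is normalized and every \<open>w j\<close> is interior. Each condition fails on
  a null set, and there are finitely many coordinates. This is what simplifies the argument of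
  \<open>c3\<close>.\<close>

lemma AE_cond_cdf_couple:
  fixes I :: "'i set"
  assumes "finite I"
  shows "AE p in PiM I (\<lambda>_. unif) \<Otimes>\<^sub>M PiM I (\<lambda>_. unif).
    \<forall>j\<in>I. cond_cdf c2 (snd (couple I p j)) (fst (couple I p j)) = snd p j"
proof -
  interpret unif: prob_space unif by (rule prob_space_unif)
  interpret P: product_prob_space "\<lambda>_. unif" I ..
  interpret PP: pair_prob_space "PiM I (\<lambda>_. unif)" "PiM I (\<lambda>_. unif)" ..
  have u: "AE u in PiM I (\<lambda>_. unif). \<forall>j\<in>I. normalized (u j)"
    using assms AE_normalized by (intro AE_finite_allI AE_PiM_component[OF prob_space_unif]) auto
  have w: "AE w in PiM I (\<lambda>_. unif). \<forall>j\<in>I. 0 < w j \<and> w j < 1"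
    using assms AE_unif by (intro AE_finite_allI AE_PiM_component[OF prob_space_unif]) auto
  have "AE p in PiM I (\<lambda>_. unif) \<Otimes>\<^sub>M PiM I (\<lambda>_. unif).
      (\<forall>j\<in>I. normalized (fst p j)) \<and> (\<forall>j\<in>I. 0 < snd p j \<and> snd p j < 1)"
  proof (rule PP.AE_pair_measure)
    show "{x \<in> space (PiM I (\<lambda>_. unif) \<Otimes>\<^sub>M PiM I (\<lambda>_. unif)). (\<forall>j\<in>I. normalized (fst x j)) \<and>
        (\<forall>j\<in>I. 0 < snd x j \<and> snd x j < 1)} \<in> sets (PiM I (\<lambda>_. unif) \<Otimes>\<^sub>M PiM I (\<lambda>_. unif))"
      using assms by measurable
    show "AE x in PiM I (\<lambda>_. unif). AE y in PiM I (\<lambda>_. unif).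
        (\<forall>j\<in>I. normalized (fst (x, y) j)) \<and> (\<forall>j\<in>I. 0 < snd (x, y) j \<and> snd (x, y) j < 1)"
      using u by eventually_elim (use w in simp)
  qed
  then show ?thesis
    by eventually_elim (auto simp: couple_def cond_cdf_quantile)
qed

lemma PiM_unif:
  assumes "finite I"
  shows "PiM I (\<lambda>_. unif) = density (PiM I (\<lambda>_. lborel)) (\<lambda>x. \<Prod>i\<in>I. indicator {0..1} (x i))"
  unfolding unif_eq_density
  using assms prob_space_unif
  by (intro PiM_density) (auto simp: unif_eq_density sigma_finite_lborel
      intro!: prob_space_imp_sigma_finite)

text \<open>The product of uniform laws has the indicator of the cube as Lebesgue density, and
  multiplying it by a function that vanishes off the cube changes nothing. Copula densities can thus
  be used relative to independent uniforms, the setting of the almost sure inversion.\<close>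

lemma density_PiM_unif:
  assumes "finite I" and f [measurable]: "f \<in> borel_measurable (PiM I (\<lambda>_. lborel))"
    and out: "\<And>x i. x \<in> space (PiM I (\<lambda>_. lborel)) \<Longrightarrow> i \<in> I \<Longrightarrow> x i \<notin> {0..1} \<Longrightarrow> f x = 0"
  shows "density (PiM I (\<lambda>_. unif)) f = density (PiM I (\<lambda>_. lborel)) f"
proof -
  have "density (PiM I (\<lambda>_. unif)) f =
    density (PiM I (\<lambda>_. lborel)) (\<lambda>x. (\<Prod>i\<in>I. indicator {0..1} (x i)) * f x)"
    unfolding PiM_unif[OF assms(1)] by (rule density_density_eq) measurable
  also have "\<dots> = density (PiM I (\<lambda>_. lborel)) f"
  proof (rule density_cong)
    show "AE x in PiM I (\<lambda>_. lborel). (\<Prod>i\<in>I. indicator {0..1} (x i)) * f x = f x"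
    proof (rule AE_I2)
      fix x :: "'a \<Rightarrow> real" assume x: "x \<in> space (PiM I (\<lambda>_. lborel))"
      show "(\<Prod>i\<in>I. indicator {0..1} (x i)) * f x = f x"
      proof (cases "\<forall>i\<in>I. x i \<in> {0..1}")
        case True
        then have "(\<Prod>i\<in>I. indicator {0..1} (x i)) = (1::ennreal)" by (intro prod.neutral) auto
        then show ?thesis by simp
      next
        case False
        then show ?thesis using out[OF x] by auto
      qed
    qed
  qed measurable
  finally show ?thesis .
qed

lemma measurable_joint_density:
  assumes "c1 n \<in> borel_measurable (lborel_n n)" "c3 n \<in> borel_measurable (lborel_n n)"
  shows "joint_density c1 c2 c3 n \<in> borel_measurable (lborel_n n)"
    and "(\<lambda>z. c1 n (\<lambda>j\<in>{1..n}. fst (z j))) \<in> borel_measurable (lborel_n n)"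
    and "(\<lambda>z. c3 n (\<lambda>j\<in>{1..n}. cond_cdf c2 (snd (z j)) (fst (z j)))) \<in> borel_measurable (lborel_n n)"
proof -
  have proj: "(\<lambda>z. fst (z j)) \<in> borel_measurable (lborel_n n)"
    "(\<lambda>z. snd (z j)) \<in> borel_measurable (lborel_n n)"
    "(\<lambda>z. c2 (z j)) \<in> borel_measurable (lborel_n n)" if "j \<in> {1..n}" for j
    using that c2_borel
    by (auto intro!: measurable_compose[OF measurable_component_singleton] borel_measurable_continuous_onI
        continuous_intros)
  show 1: "(\<lambda>z. c1 n (\<lambda>j\<in>{1..n}. fst (z j))) \<in> borel_measurable (lborel_n n)"
    by (rule measurable_compose[OF measurable_restrict assms(1)]) (use proj in auto)
  show 2: "(\<lambda>z. c3 n (\<lambda>j\<in>{1..n}. cond_cdf c2 (snd (z j)) (fst (z j)))) \<in> borel_measurable (lborel_n n)"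
    by (rule measurable_compose[OF measurable_restrict assms(2)])
      (use proj in \<open>auto intro!: cond_cdf_measurable\<close>)
  show "joint_density c1 c2 c3 n \<in> borel_measurable (lborel_n n)"
    unfolding joint_density_def prod.collapse
    by (intro borel_measurable_times borel_measurable_prod 1 2 proj)
qed

text \<open>The \<open>c2\<close> factors turn Lebesgue measure into the image of two independent
  uniform vectors under \<open>couple\<close>. The remaining factor, pulled back through
  \<open>couple\<close>, is almost everywhere \<open>c1 n u * c3 n w\<close>, and such a product
  density makes the two vectors independent with the prescribed laws.\<close>

lemma density_joint_density:
  assumes c1: "copula_density (lborel_n n) (coords1 n) (c1 n)"
    and c3: "copula_density (lborel_n n) (coords1 n) (c3 n)"
  shows "density (lborel_n n) (joint_density c1 c2 c3 n) =
    distr (density (lborel_n n) (c1 n) \<Otimes>\<^sub>M density (lborel_n n) (c3 n)) (lborel_n n) (couple {1..n})"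
proof -
  interpret unif: prob_space unif by (rule prob_space_unif)
  interpret U: product_prob_space "\<lambda>_::nat. unif" "{1..n}" ..
  let ?U = "PiM {1..n} (\<lambda>_. unif)"
  \<comment> \<open>What is left of the joint density once the \<open>c2\<close> factors have moved
    into the reference measure.\<close>
  define h where "h z = ennreal (c1 n (\<lambda>j\<in>{1..n}. fst (z j))) *
      ennreal (c3 n (\<lambda>j\<in>{1..n}. cond_cdf c2 (snd (z j)) (fst (z j))))" for z :: "nat \<Rightarrow> real \<times> real"
  note m1 [measurable] = copula_density_cubeD(1)[OF c1]
  note m3 [measurable] = copula_density_cubeD(1)[OF c3]
  have h [measurable]: "h \<in> borel_measurable (lborel_n n)"
    unfolding h_def using measurable_joint_density(2,3)[of c1 n c3, OF m1 m3] by measurable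
  have sets_U: "sets ?U = sets (lborel_n n)" by (intro sets_PiM_cong) auto
  have space_U: "space ?U = space (lborel_n n)" by (rule sets_eq_imp_space_eq[OF sets_U])
  have couple_U [measurable]: "couple {1..n} \<in> ?U \<Otimes>\<^sub>M ?U \<rightarrow>\<^sub>M lborel_n n"
    using couple_measurable by (subst measurable_cong_sets[OF sets_pair_measure_cong[OF sets_U sets_U] refl])
  have m1' [measurable]: "c1 n \<in> borel_measurable ?U" and m3' [measurable]: "c3 n \<in> borel_measurable ?U"
    using m1 m3 by (simp_all cong: measurable_cong_sets add: sets_U)
  have law_U: "density ?U (\<lambda>x. ennreal (c x)) = density (lborel_n n) (\<lambda>x. ennreal (c x))"
    if c: "copula_density (lborel_n n) (coords1 n) c" for c
  proof (rule density_PiM_unif)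
    show "(\<lambda>x. ennreal (c x)) \<in> borel_measurable (lborel_n n)"
      using copula_density_cubeD(1)[OF c] by measurable
    show "ennreal (c x) = 0" if "x \<in> space (lborel_n n)" "i \<in> {1..n}" "x i \<notin> {0..1}" for x i
      unfolding copula_density_cubeD(3)[OF c that] by simp
  qed simp
  have "density (lborel_n n) (joint_density c1 c2 c3 n) =
      density (lborel_n n) (\<lambda>z. (\<Prod>j\<in>{1..n}. ennreal (c2 (z j))) * h z)"
  proof (rule density_cong)
    show "AE z in lborel_n n. ennreal (joint_density c1 c2 c3 n z) = (\<Prod>j\<in>{1..n}. ennreal (c2 (z j))) * h z"
    proof (rule AE_I2)
      fix z :: "nat \<Rightarrow> real \<times> real"
      have "0 \<le> c1 n (\<lambda>j\<in>{1..n}. fst (z j))"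
        "0 \<le> c3 n (\<lambda>j\<in>{1..n}. cond_cdf c2 (snd (z j)) (fst (z j)))"
        by (auto intro!: copula_density_cubeD(2)[OF c1] copula_density_cubeD(2)[OF c3] simp: space_PiM)
      then show "ennreal (joint_density c1 c2 c3 n z) = (\<Prod>j\<in>{1..n}. ennreal (c2 (z j))) * h z"
        by (simp add: joint_density_def h_def prod_ennreal c2_nonneg prod_nonneg ennreal_mult mult_ac)
    qed
    have "(\<lambda>z. c2 (z j)) \<in> borel_measurable (lborel_n n)" if "j \<in> {1..n}" for j
      using that c2_borel by (auto intro!: measurable_compose[OF measurable_component_singleton])
    then show "(\<lambda>z. (\<Prod>j\<in>{1..n}. ennreal (c2 (z j))) * h z) \<in> borel_measurable (lborel_n n)"
      by (intro borel_measurable_times_ennreal borel_measurable_prod_ennreal h measurable_compose[OF _ measurable_ennreal])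
    show "(\<lambda>z. ennreal (joint_density c1 c2 c3 n z)) \<in> borel_measurable (lborel_n n)"
      using measurable_joint_density(1)[of c1 n c3, OF m1 m3] by measurable
  qed
  also have "\<dots> = density (density (lborel_n n) (\<lambda>z. \<Prod>j\<in>{1..n}. ennreal (c2 (z j)))) h"
    by (rule density_density_eq[symmetric]) (use c2_borel in \<open>measurable\<close>)
  also have "density (lborel_n n) (\<lambda>z. \<Prod>j\<in>{1..n}. ennreal (c2 (z j))) = PiM {1..n} (\<lambda>_. density lborel c2)"
    by (rule PiM_density[symmetric])
      (use copula in \<open>auto simp: copula_density_def sigma_finite_lborel intro: prob_space_imp_sigma_finite\<close>)
  \<comment> \<open>Each observation is an image of a uniform pair; regrouping collects all first
    and all second uniforms into two independent vectors.\<close>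
  also have "\<dots> = distr (?U \<Otimes>\<^sub>M ?U) (lborel_n n) (couple {1..n})"
    unfolding density_c2_eq_distr couple_def
    by (subst PiM_distr_pair)
      (auto simp: prob_space_unif borel_prod[symmetric])
  \<comment> \<open>Pulling a density back through an image measure is plain composition, so the map
    need be neither injective nor differentiable.\<close>
  also have "density \<dots> h = distr (density (?U \<Otimes>\<^sub>M ?U) (\<lambda>p. h (couple {1..n} p))) (lborel_n n) (couple {1..n})"
    by (rule density_distr) measurable
  also have "density (?U \<Otimes>\<^sub>M ?U) (\<lambda>p. h (couple {1..n} p)) =
    density (?U \<Otimes>\<^sub>M ?U) (\<lambda>(u, w). ennreal (c1 n u) * ennreal (c3 n w))"
  proof (rule density_cong)
    show "AE p in ?U \<Otimes>\<^sub>M ?U. h (couple {1..n} p) = (case p of (u, w) \<Rightarrow> ennreal (c1 n u) * ennreal (c3 n w))"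
      using AE_cond_cdf_couple[OF finite_atLeastAtMost, of 1 n] AE_space
    proof eventually_elim
      fix p assume p: "\<forall>j\<in>{1..n}. cond_cdf c2 (snd (couple {1..n} p j)) (fst (couple {1..n} p j)) = snd p j"
        "p \<in> space (PiM {1..n} (\<lambda>_. unif) \<Otimes>\<^sub>M PiM {1..n} (\<lambda>_. unif))"
      have "(\<lambda>j\<in>{1..n}. fst (couple {1..n} p j)) = (\<lambda>j\<in>{1..n}. fst p j)"
        by (auto simp: couple_def fun_eq_iff)
      also have "\<dots> = fst p" using p(2) by (auto simp: space_pair_measure space_PiM)
      finally have 1: "(\<lambda>j\<in>{1..n}. fst (couple {1..n} p j)) = fst p" .
      have "(\<lambda>j\<in>{1..n}. cond_cdf c2 (snd (couple {1..n} p j)) (fst (couple {1..n} p j))) = (\<lambda>j\<in>{1..n}. snd p j)"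
        using p(1) by (auto simp: fun_eq_iff)
      also have "\<dots> = snd p" using p(2) by (auto simp: space_pair_measure space_PiM)
      finally show "h (couple {1..n} p) = (case p of (u, w) \<Rightarrow> ennreal (c1 n u) * ennreal (c3 n w))"
        using 1 by (simp add: h_def case_prod_beta)
    qed
  qed measurable
  also have "\<dots> = density ?U (c1 n) \<Otimes>\<^sub>M density ?U (c3 n)"
  proof (rule pair_measure_density[symmetric])
    show "sigma_finite_measure (density ?U (\<lambda>x. ennreal (c3 n x)))"
      unfolding law_U[OF c3] by (rule prob_space_imp_sigma_finite[OF copula_density_cubeD(4)[OF c3]])
    show "sigma_finite_measure ?U"
      by (rule prob_space_imp_sigma_finite[OF prob_space_PiM]) (rule prob_space_unif)
  qed measurable
  finally show ?thesis
    unfolding law_U[OF c1] law_U[OF c3] .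
qed

section \<open>Consequences of the coupling: exchangeability, margins, conditional
  independence\<close>

lemma measurable_couple_law: "couple {1..n} \<in> law_n c1 n \<Otimes>\<^sub>M law_n c3 n \<rightarrow>\<^sub>M lborel_n n"
  using couple_measurable
  by (subst measurable_cong_sets[OF sets_pair_measure_cong refl, OF sets_density sets_density])

text \<open>\<open>couple\<close> applies the same map to every coordinate and so commutes with any
  relabelling \<open>\<tau>\<close>, which then acts on each of the two independent vectors
  separately. A permutation gives symmetry, the inclusion of \<open>{1..r}\<close> gives
  consistency.\<close>

lemma distr_reindex_joint:
  assumes c1: "copula_density (lborel_n n) (coords1 n) (c1 n)" "copula_density (lborel_n r) (coords1 r) (c1 r)"
    and c3: "copula_density (lborel_n n) (coords1 n) (c3 n)" "copula_density (lborel_n r) (coords1 r) (c3 r)"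
    and \<tau>: "\<tau> \<in> {1..r} \<rightarrow> {1..n}"
    and d1: "distr (law_n c1 n) (lborel_n r) (reindex r \<tau>) = law_n c1 r"
    and d3: "distr (law_n c3 n) (lborel_n r) (reindex r \<tau>) = law_n c3 r"
  shows "distr (law_n (joint_density c1 c2 c3) n) (lborel_n r) (reindex r \<tau>) =
    law_n (joint_density c1 c2 c3) r"
proof -
  have re: "reindex r \<tau> \<in> lborel_n n \<rightarrow>\<^sub>M (lborel_n r :: (nat \<Rightarrow> real) measure)"
    "reindex r \<tau> \<in> lborel_n n \<rightarrow>\<^sub>M (lborel_n r :: (nat \<Rightarrow> real \<times> real) measure)"
    by (intro measurable_reindex \<tau>)+
  have re': "reindex r \<tau> \<in> law_n c n \<rightarrow>\<^sub>M (lborel_n r :: (nat \<Rightarrow> real) measure)" for c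
    using re(1) by (subst measurable_cong_sets[OF sets_density refl])
  let ?re = "\<lambda>(u, w). (reindex r \<tau> u, reindex r \<tau> w)"
  have pair: "?re \<in> law_n c1 n \<Otimes>\<^sub>M law_n c3 n \<rightarrow>\<^sub>M lborel_n r \<Otimes>\<^sub>M lborel_n r"
    unfolding case_prod_beta
    by (intro measurable_Pair measurable_compose[OF measurable_fst re'] measurable_compose[OF measurable_snd re'])
  have "distr (law_n (joint_density c1 c2 c3) n) (lborel_n r) (reindex r \<tau>) =
    distr (law_n c1 n \<Otimes>\<^sub>M law_n c3 n) (lborel_n r) (reindex r \<tau> \<circ> couple {1..n})"
    unfolding density_joint_density[of n c1 c3, OF c1(1) c3(1)]
    by (rule distr_distr[OF re(2) measurable_couple_law])
  also have "\<dots> = distr (law_n c1 n \<Otimes>\<^sub>M law_n c3 n) (lborel_n r) (couple {1..r} \<circ> ?re)"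
    using \<tau> by (intro distr_cong) (auto simp: couple_def fun_eq_iff Pi_iff)
  also have "\<dots> = distr (distr (law_n c1 n \<Otimes>\<^sub>M law_n c3 n) (lborel_n r \<Otimes>\<^sub>M lborel_n r) ?re)
      (lborel_n r) (couple {1..r})"
    by (rule distr_distr[OF couple_measurable pair, symmetric])
  also have "distr (law_n c1 n \<Otimes>\<^sub>M law_n c3 n) (lborel_n r \<Otimes>\<^sub>M lborel_n r) ?re =
    distr (law_n c1 n) (lborel_n r) (reindex r \<tau>) \<Otimes>\<^sub>M distr (law_n c3 n) (lborel_n r) (reindex r \<tau>)"
  proof (rule pair_measure_distr[symmetric])
    show "sigma_finite_measure (distr (law_n c3 n) (lborel_n r) (reindex r \<tau>))"
      unfolding d3 using copula_density_cubeD(4)[OF c3(2)] by (rule prob_space_imp_sigma_finite)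
  qed (rule re')+
  also have "distr \<dots> (lborel_n r) (couple {1..r}) = law_n (joint_density c1 c2 c3) r"
    unfolding d1 d3 by (rule density_joint_density[of r c1 c3, OF c1(2) c3(2), symmetric])
  finally show ?thesis .
qed

text \<open>Off the cube some \<open>c2\<close> factor vanishes. For the margins, a first coordinate
  is a coordinate of the \<open>c1\<close> vector, and a second coordinate is the quantile transform
  of an independent uniform pair.\<close>

lemma copula_density_joint_density:
  assumes c1: "copula_density (lborel_n n) (coords1 n) (c1 n)"
    and c3: "copula_density (lborel_n n) (coords1 n) (c3 n)"
  shows "copula_density (lborel_n n) (coords2 n) (joint_density c1 c2 c3 n)"
  unfolding copula_density_def
proof (intro conjI ballI impI)
  interpret D1: prob_space "law_n c1 n" by (rule copula_density_cubeD(4)[OF c1])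
  interpret D3: prob_space "law_n c3 n" by (rule copula_density_cubeD(4)[OF c3])
  interpret D: pair_prob_space "law_n c1 n" "law_n c3 n" ..
  note law = density_joint_density[of n c1 c3, OF c1 c3]
  show meas: "joint_density c1 c2 c3 n \<in> borel_measurable (lborel_n n)"
    by (rule measurable_joint_density(1)[of c1 n c3, OF copula_density_cubeD(1)[OF c1] copula_density_cubeD(1)[OF c3]])
  have sp1: "(\<lambda>j\<in>{1..n}. fst (z j)) \<in> space (lborel_n n)"
    and sp3: "(\<lambda>j\<in>{1..n}. cond_cdf c2 (snd (z j)) (fst (z j))) \<in> space (lborel_n n)" for z :: "nat \<Rightarrow> real \<times> real"
    by (simp_all add: space_PiM)
  show "0 \<le> joint_density c1 c2 c3 n z" for z
    unfolding joint_density_def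
    by (intro mult_nonneg_nonneg prod_nonneg c2_nonneg copula_density_cubeD(2)[OF c1 sp1]
        copula_density_cubeD(2)[OF c3 sp3])
  show "joint_density c1 c2 c3 n z = 0" if out: "\<exists>p\<in>coords2 n. p z \<notin> {0..1}" for z
  proof -
    from out obtain j where j: "j \<in> {1..n}" and "fst (z j) \<notin> {0..1} \<or> snd (z j) \<notin> {0..1}"
      unfolding coords2_def by blast
    then have "c2 (fst (z j), snd (z j)) = 0" by (intro c2_outside)
    then have "(\<Prod>j=1..n. c2 (fst (z j), snd (z j))) = 0"
      using j by (intro prod_zero) auto
    then show ?thesis by (simp add: joint_density_def)
  qed
  show "prob_space (law_n (joint_density c1 c2 c3) n)"
    unfolding law by (rule D.prob_space_distr) (rule measurable_couple_law)
  fix p assume "p \<in> coords2 n"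
  then obtain j where j: "j \<in> {1..n}" and p: "p = (\<lambda>z. fst (z j)) \<or> p = (\<lambda>z. snd (z j))"
    unfolding coords2_def by blast
  have proj: "(\<lambda>u. u j) \<in> lborel_n n \<rightarrow>\<^sub>M (borel :: real measure)"
    using measurable_component_singleton[OF j, of "\<lambda>_. lborel :: real measure"] by simp
  have proj_law: "(\<lambda>u. u j) \<in> law_n c n \<rightarrow>\<^sub>M (borel :: real measure)" for c
    using proj by (subst measurable_cong_sets[OF sets_density refl])
  have p_meas: "p \<in> lborel_n n \<rightarrow>\<^sub>M borel"
  proof -
    have "(\<lambda>z. z j) \<in> lborel_n n \<rightarrow>\<^sub>M (borel :: (real \<times> real) measure)"
      using measurable_component_singleton[OF j, of "\<lambda>_. lborel :: (real \<times> real) measure"] by simp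
    from measurable_compose[OF this, of fst borel] measurable_compose[OF this, of snd borel] p
    show ?thesis by (auto simp: borel_prod[symmetric])
  qed
  have "distr (law_n (joint_density c1 c2 c3) n) borel p =
    distr (law_n c1 n \<Otimes>\<^sub>M law_n c3 n) borel (p \<circ> couple {1..n})"
    unfolding law by (rule distr_distr[OF p_meas measurable_couple_law])
  also have "\<dots> = uniform_measure lborel {0..1}"
    using p
  proof
    assume p: "p = (\<lambda>z. fst (z j))"
    have "p \<circ> couple {1..n} = (\<lambda>u. u j) \<circ> fst"
      using j by (auto simp: p couple_def)
    then have "distr (law_n c1 n \<Otimes>\<^sub>M law_n c3 n) borel (p \<circ> couple {1..n}) =
      distr (distr (law_n c1 n \<Otimes>\<^sub>M law_n c3 n) (law_n c1 n) fst) borel (\<lambda>u. u j)"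
      by (simp only: distr_distr[OF proj_law measurable_fst])
    then show ?thesis
      by (simp only: D3.distr_pair_fst copula_density_cubeD(5)[OF c1 j])
  next
    assume p: "p = (\<lambda>z. snd (z j))"
    let ?q = "\<lambda>p. quantile (fst p) (snd p)"
    have eval: "(\<lambda>(u, w). (u j, w j)) \<in> law_n c1 n \<Otimes>\<^sub>M law_n c3 n \<rightarrow>\<^sub>M borel \<Otimes>\<^sub>M borel"
      unfolding case_prod_beta
      by (intro measurable_Pair measurable_compose[OF measurable_fst proj_law] measurable_compose[OF measurable_snd proj_law])
    have "p \<circ> couple {1..n} = ?q \<circ> (\<lambda>(u, w). (u j, w j))"
      using j by (auto simp: p couple_def)
    then have "distr (law_n c1 n \<Otimes>\<^sub>M law_n c3 n) borel (p \<circ> couple {1..n}) =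
      distr (distr (law_n c1 n \<Otimes>\<^sub>M law_n c3 n) (borel \<Otimes>\<^sub>M borel) (\<lambda>(u, w). (u j, w j))) borel ?q"
      by (simp only: distr_distr[OF quantile_measurable_pair eval])
    also have "distr (law_n c1 n \<Otimes>\<^sub>M law_n c3 n) (borel \<Otimes>\<^sub>M borel) (\<lambda>(u, w). (u j, w j)) = unif \<Otimes>\<^sub>M unif"
    proof -
      have "distr (law_n c1 n) borel (\<lambda>u. u j) \<Otimes>\<^sub>M distr (law_n c3 n) borel (\<lambda>u. u j) =
        distr (law_n c1 n \<Otimes>\<^sub>M law_n c3 n) (borel \<Otimes>\<^sub>M borel) (\<lambda>(u, w). (u j, w j))"
      proof (rule pair_measure_distr)
        show "sigma_finite_measure (distr (law_n c3 n) borel (\<lambda>u. u j))"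
          unfolding copula_density_cubeD(5)[OF c3 j] by (rule prob_space_imp_sigma_finite[OF prob_space_unif])
      qed (rule proj_law)+
      then show ?thesis
        by (simp only: copula_density_cubeD(5)[OF c1 j] copula_density_cubeD(5)[OF c3 j])
    qed
    \<comment> \<open>The transform is the second component of a pair whose law has density
      \<open>c2\<close>, so its law is the uniform second margin of \<open>c2\<close>.\<close>
    also have "distr (unif \<Otimes>\<^sub>M unif) borel ?q =
      distr (distr (unif \<Otimes>\<^sub>M unif) lborel (\<lambda>p. (fst p, quantile (fst p) (snd p)))) borel snd"
      by (subst distr_distr) (auto simp: borel_prod[symmetric] comp_def)
    also have "\<dots> = unif"
      unfolding density_c2_eq_distr[symmetric] by (rule distr_margins(2))
    finally show ?thesis .
  qed
  finally show "distr (law_n (joint_density c1 c2 c3) n) borel p = uniform_measure lborel {0..1}" .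
qed

text \<open>Under the coupling the second coordinate at \<open>j\<close> is the quantile of
  \<open>w j\<close> given \<open>u j\<close>, and \<open>w j\<close> is uniform and independent of
  the whole vector \<open>u\<close>. Integrating out \<open>w\<close> therefore leaves a function of
  \<open>u j\<close> alone, whatever event \<open>G\<close> the vector \<open>u\<close> is
  restricted to.\<close>

lemma nn_integral_joint_kernel:
  assumes c1: "copula_density (lborel_n n) (coords1 n) (c1 n)"
    and c3: "copula_density (lborel_n n) (coords1 n) (c3 n)"
    and j: "j \<in> {1..n}" and A [measurable]: "A \<in> sets borel" and G [measurable]: "G \<in> sets (lborel_n n)"
  shows "(\<integral>\<^sup>+z. indicator A (snd (z j)) * indicator G (\<lambda>k\<in>{1..n}. fst (z k))
      \<partial>law_n (joint_density c1 c2 c3) n) =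
    (\<integral>\<^sup>+z. (\<integral>\<^sup>+w. indicator A (quantile (fst (z j)) w) \<partial>unif) * indicator G (\<lambda>k\<in>{1..n}. fst (z k))
      \<partial>law_n (joint_density c1 c2 c3) n)"
    (is "(\<integral>\<^sup>+z. ?f z \<partial>_) = (\<integral>\<^sup>+z. ?g z \<partial>_)")
proof -
  interpret unif: prob_space unif by (rule prob_space_unif)
  interpret D3: prob_space "law_n c3 n" by (rule copula_density_cubeD(4)[OF c3])
  let ?D1 = "law_n c1 n" and ?D3 = "law_n c3 n"
  let ?k = "\<lambda>u. \<integral>\<^sup>+w. indicator A (quantile u w) \<partial>unif"
  note law = density_joint_density[of n c1 c3, OF c1 c3]
  have k [measurable]: "?k \<in> borel_measurable borel" by measurable
  have proj [measurable]: "(\<lambda>u. u j) \<in> ?D1 \<rightarrow>\<^sub>M borel" "(\<lambda>u. u j) \<in> ?D3 \<rightarrow>\<^sub>M borel"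
    using measurable_component_singleton[OF j, of "\<lambda>_. lborel :: real measure"] by simp_all
  have zj: "(\<lambda>z. z i) \<in> lborel_n n \<rightarrow>\<^sub>M (borel \<Otimes>\<^sub>M borel :: (real \<times> real) measure)" if "i \<in> {1..n}" for i
    using measurable_component_singleton[OF that, of "\<lambda>_. lborel :: (real \<times> real) measure"]
    by (simp add: borel_prod)
  have fst_z: "(\<lambda>z. fst (z i :: real \<times> real)) \<in> lborel_n n \<rightarrow>\<^sub>M (borel :: real measure)" if "i \<in> {1..n}" for i
    by (rule measurable_compose[OF zj[OF that] measurable_fst])
  have snd_z: "(\<lambda>z. snd (z i :: real \<times> real)) \<in> lborel_n n \<rightarrow>\<^sub>M (borel :: real measure)" if "i \<in> {1..n}" for i
    by (rule measurable_compose[OF zj[OF that] measurable_snd])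
  have rfst: "(\<lambda>z. \<lambda>k\<in>{1..n}. fst (z k :: real \<times> real)) \<in> lborel_n n \<rightarrow>\<^sub>M (lborel_n n :: (nat \<Rightarrow> real) measure)"
    by (rule measurable_restrict) (use fst_z in simp)
  have indG: "(\<lambda>z. indicator G (\<lambda>k\<in>{1..n}. fst (z k :: real \<times> real)) :: ennreal) \<in> borel_measurable (lborel_n n)"
    by (rule measurable_compose[OF rfst borel_measurable_indicator[OF G]])
  have f: "?f \<in> borel_measurable (lborel_n n)"
    by (intro borel_measurable_times_ennreal indG
        measurable_compose[OF snd_z[OF j] borel_measurable_indicator[OF A]])
  have g: "?g \<in> borel_measurable (lborel_n n)"
    by (intro borel_measurable_times_ennreal indG measurable_compose[OF fst_z[OF j] k])
  have G_D1 [measurable]: "G \<in> sets ?D1" using G by (simp only: sets_density)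
  have couple_simps: "(\<lambda>k\<in>{1..n}. fst (couple {1..n} (u, w) k)) = u"
    "fst (couple {1..n} (u, w) j) = u j" "snd (couple {1..n} (u, w) j) = quantile (u j) (w j)"
    if "u \<in> space ?D1" for u w
    using that j by (auto simp: couple_def space_PiM PiE_iff extensional_def fun_eq_iff)
  have "(\<integral>\<^sup>+z. ?f z \<partial>law_n (joint_density c1 c2 c3) n) = (\<integral>\<^sup>+p. ?f (couple {1..n} p) \<partial>(?D1 \<Otimes>\<^sub>M ?D3))"
    unfolding law by (rule nn_integral_distr[OF measurable_couple_law, unfolded measurable_distr_eq1, OF f])
  also have "\<dots> = (\<integral>\<^sup>+u. \<integral>\<^sup>+w. ?f (couple {1..n} (u, w)) \<partial>?D3 \<partial>?D1)"
    by (rule D3.nn_integral_fst[symmetric]) (rule measurable_compose[OF measurable_couple_law f])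
  also have "\<dots> = (\<integral>\<^sup>+u. \<integral>\<^sup>+w. indicator A (quantile (u j) (w j)) * indicator G u \<partial>?D3 \<partial>?D1)"
    by (intro nn_integral_cong) (simp only: couple_simps)
  also have "\<dots> = (\<integral>\<^sup>+u. ?k (u j) * indicator G u \<partial>?D1)"
  proof (rule nn_integral_cong)
    fix u
    have q: "(\<lambda>x. indicator A (quantile (u j) x) :: ennreal) \<in> borel_measurable borel"
      by measurable
    have "(\<integral>\<^sup>+w. indicator A (quantile (u j) (w j)) * indicator G u \<partial>?D3) =
        (\<integral>\<^sup>+w. indicator A (quantile (u j) (w j)) \<partial>?D3) * indicator G u"
      by (rule nn_integral_multc) (rule measurable_compose[OF proj(2) q])
    also have "(\<integral>\<^sup>+w. indicator A (quantile (u j) (w j)) \<partial>?D3) =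
        (\<integral>\<^sup>+x. indicator A (quantile (u j) x) \<partial>distr ?D3 borel (\<lambda>w. w j))"
      by (rule nn_integral_distr[OF proj(2), unfolded measurable_distr_eq1, OF q, symmetric])
    finally show "(\<integral>\<^sup>+w. indicator A (quantile (u j) (w j)) * indicator G u \<partial>?D3) = ?k (u j) * indicator G u"
      by (simp only: copula_density_cubeD(5)[OF c3 j])
  qed
  \<comment> \<open>The integrand is free of \<open>w\<close>; a trivial integration over a
    probability law restores \<open>w\<close>, so that the expression can be carried back through
    \<open>couple\<close>.\<close>
  also have "\<dots> = (\<integral>\<^sup>+u. \<integral>\<^sup>+w. ?k (u j) * indicator G u \<partial>?D3 \<partial>?D1)"
    by (simp only: nn_integral_const D3.emeasure_space_1 mult_1_right)
  also have "\<dots> = (\<integral>\<^sup>+u. \<integral>\<^sup>+w. ?g (couple {1..n} (u, w)) \<partial>?D3 \<partial>?D1)"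
    by (intro nn_integral_cong) (simp only: couple_simps)
  also have "\<dots> = (\<integral>\<^sup>+p. ?g (couple {1..n} p) \<partial>(?D1 \<Otimes>\<^sub>M ?D3))"
    by (rule D3.nn_integral_fst) (rule measurable_compose[OF measurable_couple_law g])
  also have "\<dots> = (\<integral>\<^sup>+z. ?g z \<partial>law_n (joint_density c1 c2 c3) n)"
    unfolding law by (rule nn_integral_distr[OF measurable_couple_law, unfolded measurable_distr_eq1, OF g, symmetric])
  finally show ?thesis .
qed

text \<open>The kernel required by \<open>cond_indep_varI\<close> is the probability that the
  quantile transform of a uniform variable at \<open>u\<close> lands in \<open>A\<close>. The
  identity to be checked involves only the joint law, so it is transferred from the
  coupling.\<close>

lemma cond_indep_joint_density:
  fixes M :: "'m measure" and U V :: "nat \<Rightarrow> 'm \<Rightarrow> real"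
  assumes c1: "copula_density (lborel_n n) (coords1 n) (c1 n)"
    and c3: "copula_density (lborel_n n) (coords1 n) (c3 n)"
    and M: "prob_space M"
    and distr: "distributed M (lborel_n n) (\<lambda>\<omega>. \<lambda>j\<in>{1..n}. (U j \<omega>, V j \<omega>))
      (\<lambda>z. ennreal (joint_density c1 c2 c3 n z))"
    and j: "j \<in> {1..n}"
  shows "cond_indep_var M borel (V j) (PiM ({1..n} - {j}) (\<lambda>_. borel))
    (\<lambda>\<omega>. \<lambda>k\<in>{1..n} - {j}. U k \<omega>) borel (U j)"
proof (rule cond_indep_varI[OF M])
  interpret M: prob_space M by (rule M)
  interpret unif: prob_space unif by (rule prob_space_unif)
  define X where "X \<omega> = (\<lambda>j\<in>{1..n}. (U j \<omega>, V j \<omega>))" for \<omega>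
  have X: "X \<in> M \<rightarrow>\<^sub>M lborel_n n" and law: "distr M (lborel_n n) X = law_n (joint_density c1 c2 c3) n"
    using distr by (simp_all add: distributed_def X_def[abs_def])
  have UV: "(\<lambda>\<omega>. (U k \<omega>, V k \<omega>)) \<in> M \<rightarrow>\<^sub>M borel \<Otimes>\<^sub>M borel" if "k \<in> {1..n}" for k
    using measurable_compose[OF X measurable_component_singleton[OF that, of "\<lambda>_. lborel"]] that
    by (simp add: X_def borel_prod)
  have U: "U k \<in> borel_measurable M" and V: "V k \<in> borel_measurable M" if "k \<in> {1..n}" for k
    using measurable_compose[OF UV[OF that] measurable_fst] measurable_compose[OF UV[OF that] measurable_snd]
    by simp_all
  show Vj [measurable]: "V j \<in> borel_measurable M" by (rule V[OF j])
  show Uj [measurable]: "U j \<in> borel_measurable M" by (rule U[OF j])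
  let ?Y = "\<lambda>\<omega>. \<lambda>k\<in>{1..n} - {j}. U k \<omega>"
  show Y [measurable]: "?Y \<in> M \<rightarrow>\<^sub>M PiM ({1..n} - {j}) (\<lambda>_. borel)"
    by (rule measurable_restrict) (use U in simp)
  fix A :: "real set" assume A [measurable]: "A \<in> sets borel"
  define k where "k u = (\<integral>\<^sup>+w. indicator A (quantile u w) \<partial>unif)" for u
  have k [measurable]: "k \<in> borel_measurable borel" unfolding k_def by measurable
  have k_le: "k u \<le> 1" for u
  proof -
    have "k u \<le> (\<integral>\<^sup>+w. 1 \<partial>unif)" unfolding k_def by (intro nn_integral_mono) (simp add: indicator_def)
    then show ?thesis by (simp add: unif.emeasure_space_1)
  qed
  \<comment> \<open>\<open>k\<close> is at most 1, hence finite, so passing to a real-valued kernel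
    loses nothing.\<close>
  define p where "p u = enn2real (k u)" for u
  have kp: "k u = ennreal (p u)" for u
    using le_less_trans[OF k_le[of u] ennreal_one_less_top] by (simp add: p_def)
  have p [measurable]: "p \<in> borel_measurable borel" unfolding p_def by measurable
  have p01: "0 \<le> p u" "p u \<le> 1" for u
    using k_le[of u] by (simp_all add: p_def enn2real_leI)
  have "(\<integral>\<omega>. indicator A (V j \<omega>) * indicator B (?Y \<omega>) * indicator D (U j \<omega>) \<partial>M) =
      (\<integral>\<omega>. p (U j \<omega>) * indicator B (?Y \<omega>) * indicator D (U j \<omega>) \<partial>M)"
    if B [measurable]: "B \<in> sets (PiM ({1..n} - {j}) (\<lambda>_. borel))" and D [measurable]: "D \<in> sets borel" for B D
  proof -
    \<comment> \<open>One event of the full vector of first coordinates encodes both the condition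
      on the other coordinates and the condition on coordinate \<open>j\<close>.\<close>
    define G where "G = {u \<in> space (lborel_n n). restrict u ({1..n} - {j}) \<in> B \<and> u j \<in> D}"
    have "(\<lambda>u. restrict u ({1..n} - {j})) \<in> lborel_n n \<rightarrow>\<^sub>M PiM ({1..n} - {j}) (\<lambda>_. borel :: real measure)"
      by (rule measurable_restrict) (use measurable_component_singleton[of _ "{1..n}" "\<lambda>_. lborel :: real measure"] in simp)
    from sets.Int[OF measurable_sets[OF this B]
      measurable_sets[OF measurable_component_singleton[OF j, of "\<lambda>_. lborel :: real measure"], of D]]
    have "((\<lambda>u. restrict u ({1..n} - {j})) -` B \<inter> space (lborel_n n)) \<inter>
        ((\<lambda>u. u j) -` D \<inter> space (lborel_n n)) \<in> sets (lborel_n n)"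
      using D by simp
    also have "((\<lambda>u. restrict u ({1..n} - {j})) -` B \<inter> space (lborel_n n)) \<inter>
        ((\<lambda>u. u j) -` D \<inter> space (lborel_n n)) = G"
      by (auto simp: G_def)
    finally have G: "G \<in> sets (lborel_n n)" .
    have ind_G: "indicator G (\<lambda>k\<in>{1..n}. fst (X \<omega> k)) = (indicator B (?Y \<omega>) * indicator D (U j \<omega>) :: ennreal)" for \<omega>
    proof -
      have "(\<lambda>k\<in>{1..n}. fst (X \<omega> k)) = (\<lambda>k\<in>{1..n}. U k \<omega>)" by (auto simp: X_def)
      moreover have "restrict (\<lambda>k\<in>{1..n}. U k \<omega>) ({1..n} - {j}) = ?Y \<omega>" by (auto simp: restrict_def)
      moreover have "(\<lambda>k\<in>{1..n}. U k \<omega>) \<in> space (lborel_n n)" by (simp add: space_PiM)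
      ultimately show ?thesis using j unfolding G_def by (simp add: indicator_def)
    qed
    have Xj: "fst (X \<omega> j) = U j \<omega>" "snd (X \<omega> j) = V j \<omega>" for \<omega> using j by (simp_all add: X_def)
    note kern = nn_integral_joint_kernel[of n c1 c3, OF c1 c3 j A G, folded law k_def]
    have zj: "(\<lambda>z. z i) \<in> lborel_n n \<rightarrow>\<^sub>M (borel \<Otimes>\<^sub>M borel :: (real \<times> real) measure)" if "i \<in> {1..n}" for i
      using measurable_component_singleton[OF that, of "\<lambda>_. lborel :: (real \<times> real) measure"]
      by (simp add: borel_prod)
    have rfst: "(\<lambda>z. \<lambda>k\<in>{1..n}. fst (z k :: real \<times> real)) \<in> lborel_n n \<rightarrow>\<^sub>M (lborel_n n :: (nat \<Rightarrow> real) measure)"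
      by (rule measurable_restrict) (use measurable_compose[OF zj measurable_fst] in simp)
    have indG: "(\<lambda>z. indicator G (\<lambda>k\<in>{1..n}. fst (z k :: real \<times> real)) :: ennreal) \<in> borel_measurable (lborel_n n)"
      by (rule measurable_compose[OF rfst borel_measurable_indicator[OF G]])
    have f: "(\<lambda>z. indicator A (snd (z j)) * indicator G (\<lambda>k\<in>{1..n}. fst (z k)) :: ennreal) \<in> borel_measurable (lborel_n n)"
      by (intro borel_measurable_times_ennreal indG
          measurable_compose[OF measurable_compose[OF zj[OF j] measurable_snd] borel_measurable_indicator[OF A]])
    have g: "(\<lambda>z. k (fst (z j :: real \<times> real)) * indicator G (\<lambda>k\<in>{1..n}. fst (z k))) \<in> borel_measurable (lborel_n n)"
      by (intro borel_measurable_times_ennreal indG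
          measurable_compose[OF measurable_compose[OF zj[OF j] measurable_fst] k])
    have eq: "(\<integral>\<^sup>+\<omega>. indicator A (V j \<omega>) * (indicator B (?Y \<omega>) * indicator D (U j \<omega>)) \<partial>M) =
      (\<integral>\<^sup>+\<omega>. k (U j \<omega>) * (indicator B (?Y \<omega>) * indicator D (U j \<omega>)) \<partial>M)"
      using kern unfolding nn_integral_distr[OF X, unfolded measurable_distr_eq1, OF f] nn_integral_distr[OF X, unfolded measurable_distr_eq1, OF g] Xj ind_G .
    note ind = measurable_compose[OF Vj borel_measurable_indicator[OF A]]
      measurable_compose[OF Y borel_measurable_indicator[OF B]]
      measurable_compose[OF Uj borel_measurable_indicator[OF D]]
    have mV: "(\<lambda>\<omega>. indicator A (V j \<omega>) * indicator B (?Y \<omega>) * indicator D (U j \<omega>) :: real) \<in> borel_measurable M"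
      by (intro borel_measurable_times ind)
    have mp: "(\<lambda>\<omega>. p (U j \<omega>) * indicator B (?Y \<omega>) * indicator D (U j \<omega>)) \<in> borel_measurable M"
      by (intro borel_measurable_times ind measurable_compose[OF Uj p])
    have "(\<integral>\<omega>. indicator A (V j \<omega>) * indicator B (?Y \<omega>) * indicator D (U j \<omega>) \<partial>M) =
      enn2real (\<integral>\<^sup>+\<omega>. ennreal (indicator A (V j \<omega>) * indicator B (?Y \<omega>) * indicator D (U j \<omega>)) \<partial>M)"
      by (rule integral_eq_nn_integral[OF mV]) simp
    also have "(\<integral>\<^sup>+\<omega>. ennreal (indicator A (V j \<omega>) * indicator B (?Y \<omega>) * indicator D (U j \<omega>)) \<partial>M) =
      (\<integral>\<^sup>+\<omega>. indicator A (V j \<omega>) * (indicator B (?Y \<omega>) * indicator D (U j \<omega>)) \<partial>M)"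
      by (intro nn_integral_cong) (simp add: indicator_def)
    also note eq
    also have "(\<integral>\<^sup>+\<omega>. k (U j \<omega>) * (indicator B (?Y \<omega>) * indicator D (U j \<omega>)) \<partial>M) =
      (\<integral>\<^sup>+\<omega>. ennreal (p (U j \<omega>) * indicator B (?Y \<omega>) * indicator D (U j \<omega>)) \<partial>M)"
      by (intro nn_integral_cong) (simp add: indicator_def kp)
    also have "enn2real \<dots> = (\<integral>\<omega>. p (U j \<omega>) * indicator B (?Y \<omega>) * indicator D (U j \<omega>) \<partial>M)"
      by (rule integral_eq_nn_integral[OF mp, symmetric]) (simp add: p01)
    finally show ?thesis .
  qed
  with p p01 show "\<exists>p :: real \<Rightarrow> real. p \<in> borel_measurable borel \<and> (\<forall>z. 0 \<le> p z \<and> p z \<le> 1) \<and>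
      (\<forall>B\<in>sets (PiM ({1..n} - {j}) (\<lambda>_. borel)). \<forall>D\<in>sets borel.
        (\<integral>\<omega>. indicator A (V j \<omega>) * indicator B (?Y \<omega>) * indicator D (U j \<omega>) \<partial>M) =
        (\<integral>\<omega>. p (U j \<omega>) * indicator B (?Y \<omega>) * indicator D (U j \<omega>) \<partial>M))"
    by blast
qed

end

theorem mainTheorem2:
  fixes c1 c3 :: "nat \<Rightarrow> (nat \<Rightarrow> real) \<Rightarrow> real"
    and c2 :: "real \<times> real \<Rightarrow> real"
  assumes "copula_density lborel {fst, snd} c2"
    and "exchangeable_copula_densities c1"
    and "exchangeable_copula_densities c3"
  shows "(\<forall>n\<ge>1. copula_density (lborel_n n) (coords2 n) (joint_density c1 c2 c3 n)) \<and>
    exchangeable (\<lambda>n. joint_cdf n (joint_density c1 c2 c3 n)) \<and>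
    (\<forall>n\<ge>2. \<forall>(M :: 'm measure) U V.
       prob_space M \<longrightarrow>
       distributed M (lborel_n n) (\<lambda>\<omega>. \<lambda>j\<in>{1..n}. (U j \<omega>, V j \<omega>))
         (\<lambda>z. ennreal (joint_density c1 c2 c3 n z)) \<longrightarrow>
       (\<forall>j\<in>{1..n}.
          cond_indep_var M
            borel (V j)
            (PiM ({1..n} - {j}) (\<lambda>_. borel)) (\<lambda>\<omega>. \<lambda>k\<in>{1..n} - {j}. U k \<omega>)
            borel (U j)))"
proof (intro conjI allI impI ballI)
  interpret bivariate_copula_density c2 by standard fact
  have cop1: "copula_density (lborel_n n) (coords1 n) (c1 n)"
    and cop3: "copula_density (lborel_n n) (coords1 n) (c3 n)" if "1 \<le> n" for n
    using assms(2,3) that unfolding exchangeable_copula_densities_def by blast+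
  show cop: "copula_density (lborel_n n) (coords2 n) (joint_density c1 c2 c3 n)" if "1 \<le> n" for n
    by (rule copula_density_joint_density[of n c1 c3, OF cop1[OF that] cop3[OF that]])
  have "exchangeable (\<lambda>n. joint_cdf n (c1 n))" "exchangeable (\<lambda>n. joint_cdf n (c3 n))"
    using assms(2,3) unfolding exchangeable_copula_densities_def by blast+
  then have laws: "exchangeable_laws c1" "exchangeable_laws c3"
    using exchangeable_iff_laws[of c1] exchangeable_iff_laws[of c3]
      copula_density_cubeD(4)[OF cop1] copula_density_cubeD(4)[OF cop3] by blast+
  have prob: "prob_space (law_n (joint_density c1 c2 c3) n)" if "1 \<le> n" for n
    using cop[OF that] unfolding copula_density_def by blast
  \<comment> \<open>Symmetry and consistency are both instances of the same transport along a
    relabelling of the observations.\<close>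
  have "exchangeable_laws (joint_density c1 c2 c3)"
    unfolding exchangeable_laws_def
  proof (intro allI impI conjI ballI)
    fix n :: nat assume n: "2 \<le> n"
    then have n1: "1 \<le> n" by simp
    show "distr (law_n (joint_density c1 c2 c3) n) (lborel_n n) (reindex n \<pi>) = law_n (joint_density c1 c2 c3) n"
      if \<pi>: "\<pi> permutes {1..n}" for \<pi>
    proof (rule distr_reindex_joint[of n c1 n c3, OF cop1[OF n1] cop1[OF n1] cop3[OF n1] cop3[OF n1]])
      show "\<pi> \<in> {1..n} \<rightarrow> {1..n}" using permutes_in_image[OF \<pi>] by blast
      show "distr (law_n c1 n) (lborel_n n) (reindex n \<pi>) = law_n c1 n" using laws(1) n \<pi> unfolding exchangeable_laws_def by blast
      show "distr (law_n c3 n) (lborel_n n) (reindex n \<pi>) = law_n c3 n" using laws(2) n \<pi> unfolding exchangeable_laws_def by blast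
    qed
    show "distr (law_n (joint_density c1 c2 c3) n) (lborel_n r) (reindex r (\<lambda>j. j)) = law_n (joint_density c1 c2 c3) r"
      if r: "r \<in> {1..n}" for r
    proof -
      have r1: "1 \<le> r" using r by simp
      show ?thesis
      proof (rule distr_reindex_joint[of n c1 r c3, OF cop1[OF n1] cop1[OF r1] cop3[OF n1] cop3[OF r1]])
        show "(\<lambda>j. j) \<in> {1..r} \<rightarrow> {1..n}" using r by auto
        show "distr (law_n c1 n) (lborel_n r) (reindex r (\<lambda>j. j)) = law_n c1 r" using laws(1) n r unfolding exchangeable_laws_def by blast
        show "distr (law_n c3 n) (lborel_n r) (reindex r (\<lambda>j. j)) = law_n c3 r" using laws(2) n r unfolding exchangeable_laws_def by blast
      qed
    qed
  qed
  then show "exchangeable (\<lambda>n. joint_cdf n (joint_density c1 c2 c3 n))"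
    using exchangeable_iff_laws[of "joint_density c1 c2 c3"] prob by blast
  fix n j :: nat and M :: "'m measure" and U V
  assume "2 \<le> n" "prob_space M" "j \<in> {1..n}"
    "distributed M (lborel_n n) (\<lambda>\<omega>. \<lambda>j\<in>{1..n}. (U j \<omega>, V j \<omega>)) (\<lambda>z. ennreal (joint_density c1 c2 c3 n z))"
  then show "cond_indep_var M borel (V j) (PiM ({1..n} - {j}) (\<lambda>_. borel))
      (\<lambda>\<omega>. \<lambda>k\<in>{1..n} - {j}. U k \<omega>) borel (U j)"
    by (intro cond_indep_joint_density[of n c1 c3] cop1 cop3) simp_all
qed

end
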